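(* Let $G$ be the Grigorchuk group and let $\widehat{G}$ be its profinite completion. Then for every $g \in G$, the centraliser $C_G(g)$ is dense in the centraliser $C_{\widehat{G}}(g)$.
   Context: View $\{0,1\}^*$ as the vertices of the infinite rooted binary tree $T$. The Grigorchuk group is $G = \langle a,b,c,d\rangle \leq \mathrm{Aut}(T)$, where, for all $\sigma\in\{0,1\}^*$, $a(0\sigma)=1\sigma$, $a(1\sigma)=0\sigma$; $b(0\sigma)=0a(\sigma)$, $b(1\sigma)=1c(\sigma)$; $c(0\sigma)=0a(\sigma)$, $c(1\sigma)=1d(\sigma)$; $d(0\sigma)=0\sigma$, $d(1\sigma)=1b(\sigma)$. The group $G$ is residually finite and is identified with its image under the canonical embedding $G \to \widehat{G} = \varprojlim G/N$ ($N$ ranging over finite-index normal subgroups); $\widehat{G}$ carries its profinite topology. For a subgroup $H$ of a group containing $g$, $C_H(g)=\{h\in H\mid hg=gh\}$. *)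

theory Defs
  imports
    "HOL-Algebra.Bij"
    "HOL-Algebra.Product_Groups"
    "HOL-Analysis.Function_Topology"
begin

section \<open>The binary rooted tree and the Grigorchuk group\<close>

text \<open>
  Vertices of the tree are words over \<open>{0, 1}\<close>, encoded as lists of booleans with \<open>False\<close> for
  \<open>0\<close> and \<open>True\<close> for \<open>1\<close>; the root is the empty word.
\<close>

definition tree_adj :: "bool list \<Rightarrow> bool list \<Rightarrow> bool"
  where "tree_adj u v \<longleftrightarrow> (\<exists>x. v = u @ [x] \<or> u = v @ [x])"

definition tree_Aut :: "(bool list \<Rightarrow> bool list) monoid"
  where "tree_Aut =
    (BijGroup UNIV)
      \<lparr>carrier := {f \<in> Bij UNIV. f [] = [] \<and> (\<forall>u v. tree_adj (f u) (f v) \<longleftrightarrow> tree_adj u v)}\<rparr>"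

fun grig_a :: "bool list \<Rightarrow> bool list"
  where
    "grig_a [] = []"
  | "grig_a (False # w) = True # w"
  | "grig_a (True # w) = False # w"

fun grig_b grig_c grig_d :: "bool list \<Rightarrow> bool list"
  where
    "grig_b [] = []"
  | "grig_b (False # w) = False # grig_a w"
  | "grig_b (True # w) = True # grig_c w"
  | "grig_c [] = []"
  | "grig_c (False # w) = False # grig_a w"
  | "grig_c (True # w) = True # grig_d w"
  | "grig_d [] = []"
  | "grig_d (False # w) = False # w"
  | "grig_d (True # w) = True # grig_b w"

definition Grigorchuk :: "(bool list \<Rightarrow> bool list) monoid"
  where "Grigorchuk = subgroup_generated tree_Aut {grig_a, grig_b, grig_c, grig_d}"

section \<open>Profinite completions\<close>

definition fin_index_normal :: "('a, 'b) monoid_scheme \<Rightarrow> 'a set set"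
  where "fin_index_normal G = {N. N \<lhd> G \<and> finite (rcosets\<^bsub>G\<^esub> N)}"

text \<open>
  The projection \<open>G / N \<rightarrow> G / M\<close> for \<open>N \<subseteq> M\<close>. It sends a coset \<open>C\<close> to the product set \<open>M C\<close>,
  so that \<open>N g\<close> is sent to \<open>M g\<close> (see \<open>coset_proj_r_coset\<close> below).
\<close>

definition coset_proj :: "('a, 'b) monoid_scheme \<Rightarrow> 'a set \<Rightarrow> 'a set \<Rightarrow> 'a set"
  where "coset_proj G M C = M <#>\<^bsub>G\<^esub> C"

definition profinite_completion :: "('a, 'b) monoid_scheme \<Rightarrow> ('a set \<Rightarrow> 'a set) monoid"
  where "profinite_completion G =
    (product_group (fin_index_normal G) (\<lambda>N. G Mod N))
      \<lparr>carrier := {x \<in> carrier (product_group (fin_index_normal G) (\<lambda>N. G Mod N)).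
         \<forall>N \<in> fin_index_normal G. \<forall>M \<in> fin_index_normal G. N \<subseteq> M \<longrightarrow> coset_proj G M (x N) = x M}\<rparr>"

definition profinite_topology :: "('a, 'b) monoid_scheme \<Rightarrow> ('a set \<Rightarrow> 'a set) topology"
  where "profinite_topology G =
    subtopology
      (product_topology (\<lambda>N. discrete_topology (carrier (G Mod N))) (fin_index_normal G))
      (carrier (profinite_completion G))"

definition profinite_embedding :: "('a, 'b) monoid_scheme \<Rightarrow> 'a \<Rightarrow> ('a set \<Rightarrow> 'a set)"
  where "profinite_embedding G g = (\<lambda>N \<in> fin_index_normal G. N #>\<^bsub>G\<^esub> g)"

section \<open>Centralisers and density\<close>

definition centraliser :: "('a, 'b) monoid_scheme \<Rightarrow> 'a \<Rightarrow> 'a set"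
  where "centraliser H g = {h \<in> carrier H. h \<otimes>\<^bsub>H\<^esub> g = g \<otimes>\<^bsub>H\<^esub> h}"

definition dense_in_subspace :: "'a topology \<Rightarrow> 'a set \<Rightarrow> 'a set \<Rightarrow> bool"
  where "dense_in_subspace X S A \<longleftrightarrow> A \<subseteq> S \<and> Abstract_Topology.closure_of (subtopology X S) A = S"

section \<open>Basic facts\<close>

lemma group_tree_Aut: "group tree_Aut"
proof -
  let ?H = "{f \<in> Bij UNIV. f [] = [] \<and> (\<forall>u v. tree_adj (f u) (f v) \<longleftrightarrow> tree_adj u v)}"
  interpret B: group "BijGroup (UNIV :: bool list set)"
    by (rule group_BijGroup)
  have "subgroup ?H (BijGroup UNIV)"
  proof (rule B.subgroupI)
    show "?H \<subseteq> carrier (BijGroup UNIV)"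
      by (auto simp: BijGroup_def)
    show "?H \<noteq> {}"
      by (auto simp: Bij_def intro!: exI[of _ id])
  next
    fix f assume f: "f \<in> ?H"
    then have b: "bij f" and r: "f [] = []"
      and e: "tree_adj (f u) (f v) \<longleftrightarrow> tree_adj u v" for u v
      by (auto simp: Bij_def)
    have "inv\<^bsub>BijGroup UNIV\<^esub> f = inv_into UNIV f"
      using f by (auto simp: inv_BijGroup)
    moreover have "inv_into UNIV f [] = []"
      using b r by (metis bij_inv_eq_iff)
    moreover have "tree_adj (inv_into UNIV f u) (inv_into UNIV f v) \<longleftrightarrow> tree_adj u v" for u v
      using b e[of "inv_into UNIV f u" "inv_into UNIV f v"] by (simp add: bij_is_surj surj_f_inv_f)
    moreover have "inv_into UNIV f \<in> Bij UNIV"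
      using b by (simp add: Bij_def bij_imp_bij_inv)
    ultimately show "inv\<^bsub>BijGroup UNIV\<^esub> f \<in> ?H" by simp
  next
    fix f g assume "f \<in> ?H" "g \<in> ?H"
    then show "f \<otimes>\<^bsub>BijGroup UNIV\<^esub> g \<in> ?H"
      using compose_Bij[of f UNIV g] by (auto simp: BijGroup_def compose_def)
  qed
  then show ?thesis
    unfolding tree_Aut_def by (rule B.subgroup_imp_group)
qed

lemma mult_tree_Aut:
  "f \<in> carrier tree_Aut \<Longrightarrow> g \<in> carrier tree_Aut \<Longrightarrow> f \<otimes>\<^bsub>tree_Aut\<^esub> g = f \<circ> g"
  by (auto simp: tree_Aut_def BijGroup_def compose_def)

lemma grig_a_involution: "grig_a (grig_a w) = w"
  by (induction w rule: grig_a.induct) auto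

lemma grig_bcd_involution:
  "grig_b (grig_b w) = w" "grig_c (grig_c w) = w" "grig_d (grig_d w) = w"
  by (induction w and w and w rule: grig_b_grig_c_grig_d.induct) (auto simp: grig_a_involution)

lemma tree_adj_Nil: "tree_adj [] w \<longleftrightarrow> length w = 1" "tree_adj w [] \<longleftrightarrow> length w = 1"
  by (auto simp: tree_adj_def length_Suc_conv)

lemma tree_adj_Cons: "tree_adj (x # u) (y # v) \<longleftrightarrow> x = y \<and> tree_adj u v"
  by (auto simp: tree_adj_def)

lemma length_grig_a [simp]: "length (grig_a w) = length w"
  by (induction w rule: grig_a.induct) auto

lemma length_grig_bcd [simp]:
  "length (grig_b w) = length w" "length (grig_c w) = length w" "length (grig_d w) = length w"
  by (induction w and w and w rule: grig_b_grig_c_grig_d.induct) auto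

lemma tree_adj_grig_a: "tree_adj (grig_a u) (grig_a v) \<longleftrightarrow> tree_adj u v"
  by (cases u rule: grig_a.cases; cases v rule: grig_a.cases)
    (auto simp: tree_adj_Nil tree_adj_Cons)

lemma tree_adj_grig_bcd:
  "tree_adj (grig_b u) (grig_b v) \<longleftrightarrow> tree_adj u v"
  "tree_adj (grig_c u) (grig_c v) \<longleftrightarrow> tree_adj u v"
  "tree_adj (grig_d u) (grig_d v) \<longleftrightarrow> tree_adj u v"
proof (induction u and u and u arbitrary: v and v and v rule: grig_b_grig_c_grig_d.induct)
qed (case_tac v rule: grig_a.cases; auto simp: tree_adj_Nil tree_adj_Cons tree_adj_grig_a)+

lemma grig_generators_in_tree_Aut: "{grig_a, grig_b, grig_c, grig_d} \<subseteq> carrier tree_Aut"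
proof -
  have "bij grig_a" "bij grig_b" "bij grig_c" "bij grig_d"
    by (rule involuntory_imp_bij, simp add: grig_a_involution grig_bcd_involution)+
  then show ?thesis
    by (simp add: tree_Aut_def Bij_def tree_adj_grig_a tree_adj_grig_bcd)
qed

lemma carrier_Grigorchuk:
  "carrier Grigorchuk = generate tree_Aut {grig_a, grig_b, grig_c, grig_d}"
  unfolding Grigorchuk_def carrier_subgroup_generated
  using grig_generators_in_tree_Aut by (simp add: Int_absorb1)

lemma group_Grigorchuk: "group Grigorchuk"
  unfolding Grigorchuk_def by (rule group.group_subgroup_generated[OF group_tree_Aut])

lemma coset_proj_r_coset:
  assumes "N \<lhd> G" "M \<lhd> G" "N \<subseteq> M" "g \<in> carrier G"
  shows "coset_proj G M (N #>\<^bsub>G\<^esub> g) = M #>\<^bsub>G\<^esub> g"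
proof -
  interpret N: normal N G by fact
  interpret M: normal M G by fact
  have "M <#>\<^bsub>G\<^esub> N = M"
  proof
    show "M <#>\<^bsub>G\<^esub> N \<subseteq> M"
      using assms(3) by (auto simp: set_mult_def)
    show "M \<subseteq> M <#>\<^bsub>G\<^esub> N"
    proof
      fix m assume "m \<in> M"
      have "m \<otimes>\<^bsub>G\<^esub> \<one>\<^bsub>G\<^esub> \<in> M <#>\<^bsub>G\<^esub> N"
        using \<open>m \<in> M\<close> N.one_closed unfolding set_mult_def
        by (intro UN_I[of m] UN_I[of "\<one>\<^bsub>G\<^esub>"]) simp_all
      then show "m \<in> M <#>\<^bsub>G\<^esub> N"
        using \<open>m \<in> M\<close> by simp
    qed
  qed
  then show ?thesis
    unfolding coset_proj_def using assms(4)
    by (simp add: N.setmult_rcos_assoc N.subset M.subset)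
qed

lemma (in group) profinite_embedding_in_carrier:
  assumes "g \<in> carrier G"
  shows "profinite_embedding G g \<in> carrier (profinite_completion G)"
  using assms
  by (auto simp: profinite_completion_def profinite_embedding_def carrier_FactGroup
      fin_index_normal_def coset_proj_r_coset)

lemma (in group) profinite_embedding_mult:
  assumes "g \<in> carrier G" "h \<in> carrier G"
  shows "profinite_embedding G (g \<otimes> h) =
    profinite_embedding G g \<otimes>\<^bsub>profinite_completion G\<^esub> profinite_embedding G h"
  using assms
  by (auto simp: profinite_completion_def profinite_embedding_def fin_index_normal_def
      normal.rcos_sum fun_eq_iff)

lemma topspace_profinite_topology:
  "topspace (profinite_topology G) = carrier (profinite_completion G)"
  by (auto simp: profinite_topology_def profinite_completion_def)

end

(*
Let K be the normal closure of t = abab, a subgroup of index 16 in the Grigorchuk group G with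
K x K <= K. Suppose f conjugates g to h modulo a deep level stabiliser. If g and h fix the first
level, the sections of f approximately conjugate sections of g to sections of h; if both swap the
first level, f at 0 approximately conjugates products of the two sections of g to a product of the
two sections of h. If the sections can be corrected to exact conjugators in their cosets of K, then
so can f, because whether a pair of elements of G lies in G depends only on their cosets of K. Passing to
cyclically reduced words, a suitable weight decreases in this step except when g and h lie in
{1, b, c, d}, where the claim is checked by hand. Applying the step again makes the correction as
small as desired. In particular an element commuting with g modulo a deep level stabiliser is
congruent to an element commuting with g. Density follows since every subgroup of finite index contains a
level stabiliser: a pigeonhole argument puts a copy of t, hence all of K, at some level into it.
*)
theory Submission
  imports Defs
begin

section \<open>Words and sections\<close>

datatype gen = Ga | Gb | Gc | Gd

fun act :: "gen \<Rightarrow> bool list \<Rightarrow> bool list" where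
  "act Ga = grig_a" | "act Gb = grig_b" | "act Gc = grig_c" | "act Gd = grig_d"

fun ev :: "gen list \<Rightarrow> bool list \<Rightarrow> bool list" where
  "ev [] = id" | "ev (l # w) = act l \<circ> ev w"

text \<open>The four generators are involutions, so words without inverse letters already give the
  whole group; \<open>carrier_Grigorchuk_eq\<close> makes the link to
  \<open>Grigorchuk\<close>.\<close>

definition grig :: "(bool list \<Rightarrow> bool list) set" where "grig = range ev"

fun gsec :: "gen \<Rightarrow> bool \<Rightarrow> gen list" where
  "gsec Ga x = []"
| "gsec Gb x = (if x then [Gc] else [Ga])"
| "gsec Gc x = (if x then [Gd] else [Ga])"
| "gsec Gd x = (if x then [Gb] else [])"

text \<open>Inequality of booleans is addition modulo 2, here and throughout; so
  \<open>x \<noteq> swaps f\<close> is the first-level vertex to which \<open>f\<close> moves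
  \<open>x\<close>.\<close>

fun par :: "gen list \<Rightarrow> bool" where
  "par [] = False" | "par (l # w) = ((l = Ga) \<noteq> par w)"

text \<open>\<open>ev\<close> applies the last letter of a word first, so \<open>l\<close> meets the
  vertex as \<open>w\<close> has already moved it.\<close>

fun secw :: "bool \<Rightarrow> gen list \<Rightarrow> gen list" where
  "secw x [] = []" | "secw x (l # w) = gsec l (x \<noteq> par w) @ secw x w"

definition swaps :: "(bool list \<Rightarrow> bool list) \<Rightarrow> bool" where
  "swaps f \<longleftrightarrow> f [False] = [True]"

definition sec :: "(bool list \<Rightarrow> bool list) \<Rightarrow> bool \<Rightarrow> bool list \<Rightarrow> bool list" where
  "sec f x = (\<lambda>w. tl (f (x # w)))"

text \<open>For elements of the group this is congruence modulo the stabiliser of level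
  \<open>m\<close>.\<close>

definition agree :: "nat \<Rightarrow> (bool list \<Rightarrow> bool list) \<Rightarrow> (bool list \<Rightarrow> bool list) \<Rightarrow> bool" where
  "agree m f g \<longleftrightarrow> (\<forall>w. length w \<le> m \<longrightarrow> f w = g w)"

abbreviation ginv :: "('a \<Rightarrow> 'a) \<Rightarrow> 'a \<Rightarrow> 'a" where "ginv \<equiv> inv_into UNIV"

lemma ev_append: "ev (u @ v) = ev u \<circ> ev v"
  by (induction u) auto

lemma act_Nil: "act l [] = []"
  by (cases l) auto

lemma act_Cons: "act l (x # u) = (x \<noteq> (l = Ga)) # ev (gsec l x) u"
  by (cases l; cases x) auto

lemma act_act: "act l (act l w) = w"
  by (cases l) (auto simp: grig_a_involution grig_bcd_involution)

lemma act_comp_act: "act l \<circ> act l = id"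
  by (auto simp: act_act)

lemma ev_Nil: "ev w [] = []"
  by (induction w) (auto simp: act_Nil)

lemma ev_Cons: "ev w (x # u) = (x \<noteq> par w) # ev (secw x w) u"
  by (induction w) (auto simp: act_Cons ev_append)

lemma swaps_ev [simp]: "swaps (ev w) = par w"
  by (simp add: swaps_def ev_Cons ev_Nil)

lemma sec_ev [simp]: "sec (ev w) x = ev (secw x w)"
  by (auto simp: sec_def ev_Cons)

lemma ev_rev: "ev (rev w) \<circ> ev w = id" "ev w \<circ> ev (rev w) = id"
  by (induction w) (auto simp: ev_append fun_eq_iff act_act)

section \<open>Group elements described by their swap and their two sections\<close>

lemma ev_in_grig [simp]: "ev w \<in> grig"
  by (simp add: grig_def)

lemma act_eq_ev: "act l = ev [l]"
  by simp

lemma act_in_grig [simp]: "act l \<in> grig"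
  by (subst act_eq_ev) (rule ev_in_grig)

lemma id_in_grig [simp]: "id \<in> grig"
  using ev_in_grig[of "[]"] by simp

lemma gens_in_grig [simp]: "grig_a \<in> grig" "grig_b \<in> grig" "grig_c \<in> grig" "grig_d \<in> grig"
  using act_in_grig[of Ga] act_in_grig[of Gb] act_in_grig[of Gc] act_in_grig[of Gd] by simp_all

lemma comp_in_grig [simp]: "f \<in> grig \<Longrightarrow> g \<in> grig \<Longrightarrow> f \<circ> g \<in> grig"
  by (auto simp: grig_def ev_append[symmetric])

lemma grig_induct [consumes 1, case_names id act]:
  assumes "f \<in> grig" "P id" "\<And>l f. f \<in> grig \<Longrightarrow> P f \<Longrightarrow> P (act l \<circ> f)"
  shows "P f"
proof -
  have "P (ev w)" for w
    using assms(2,3) by (induction w) (simp_all only: ev.simps ev_in_grig)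
  then show ?thesis using assms(1) by (auto simp: grig_def)
qed

lemma inv_ev: "ginv (ev w) = ev (rev w)"
  using ev_rev[of w] by (intro inv_unique_comp) auto

lemma inv_in_grig [simp]: "f \<in> grig \<Longrightarrow> ginv f \<in> grig"
  by (auto simp: grig_def inv_ev)

lemma grig_inv: assumes "f \<in> grig" shows "ginv f \<circ> f = id" "f \<circ> ginv f = id"
  using assms by (auto simp: grig_def inv_ev ev_rev)

lemma grig_bij: "f \<in> grig \<Longrightarrow> bij f"
  using grig_inv o_bij by blast

lemma grig_inv_app: assumes "f \<in> grig" shows "ginv f (f w) = w" "f (ginv f w) = w"
  using grig_inv[OF assms] by (auto simp: fun_eq_iff)

lemma grig_Nil: "f \<in> grig \<Longrightarrow> f [] = []"
  by (auto simp: grig_def ev_Nil)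

lemma grig_Cons: "f \<in> grig \<Longrightarrow> f (x # w) = (x \<noteq> swaps f) # sec f x w"
  by (auto simp: grig_def ev_Cons)

lemma sec_in_grig [simp]: "f \<in> grig \<Longrightarrow> sec f x \<in> grig"
  by (auto simp: grig_def)

lemma length_grig [simp]: "f \<in> grig \<Longrightarrow> length (f w) = length w"
  by (induction w arbitrary: f) (auto simp: grig_Nil grig_Cons)

lemma swaps_id [simp]: "swaps id = False"
  by (simp add: swaps_def)

lemma sec_id [simp]: "sec id x = id"
  by (auto simp: sec_def)

lemma swaps_comp: "f \<in> grig \<Longrightarrow> g \<in> grig \<Longrightarrow> swaps (f \<circ> g) = (swaps f \<noteq> swaps g)"
  by (auto simp: swaps_def[of "f \<circ> g"] grig_Cons grig_Nil)

lemma sec_comp: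
  "f \<in> grig \<Longrightarrow> g \<in> grig \<Longrightarrow> sec (f \<circ> g) x = sec f (x \<noteq> swaps g) \<circ> sec g x"
  by (auto simp: sec_def[of "f \<circ> g"] grig_Cons)

lemma swaps_gens [simp]: "swaps grig_a" "\<not> swaps grig_b" "\<not> swaps grig_c" "\<not> swaps grig_d"
  by (simp_all add: swaps_def)

lemma sec_gens [simp]:
  "sec grig_a x = id"
  "sec grig_b x = (if x then grig_c else grig_a)"
  "sec grig_c x = (if x then grig_d else grig_a)"
  "sec grig_d x = (if x then grig_b else id)"
  by (cases x; simp add: sec_def fun_eq_iff)+

lemma grig_eqI:
  assumes "f \<in> grig" "g \<in> grig" "swaps f = swaps g" "\<And>x. sec f x = sec g x"
  shows "f = g"
proof
  fix w show "f w = g w"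
    using assms by (cases w) (auto simp: grig_Nil grig_Cons)
qed

lemma agree_Suc:
  assumes "f \<in> grig" "g \<in> grig"
  shows "agree (Suc m) f g \<longleftrightarrow> swaps f = swaps g \<and> (\<forall>x. agree m (sec f x) (sec g x))"
    (is "?L \<longleftrightarrow> ?R")
proof
  assume L: ?L
  then have "swaps f = swaps g"
    by (simp add: agree_def swaps_def)
  moreover have "agree m (sec f x) (sec g x)" for x
    using L by (auto simp: agree_def sec_def)
  ultimately show ?R by simp
next
  assume ?R
  show ?L unfolding agree_def
  proof (intro allI impI)
    fix w :: "bool list" assume "length w \<le> Suc m"
    then show "f w = g w"
      using assms \<open>?R\<close> by (cases w) (auto simp: grig_Nil grig_Cons agree_def)
  qed
qed

lemma agree_mono: "agree m f g \<Longrightarrow> n \<le> m \<Longrightarrow> agree n f g"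
  by (auto simp: agree_def)

lemma agree_comp_left: "agree m f g \<Longrightarrow> agree m (s \<circ> f) (s \<circ> g)"
  by (auto simp: agree_def)

lemma agree_comp_right: "agree m f g \<Longrightarrow> s \<in> grig \<Longrightarrow> agree m (f \<circ> s) (g \<circ> s)"
  by (auto simp: agree_def)

lemma agree_sym: "agree m f g \<Longrightarrow> agree m g f"
  by (auto simp: agree_def)

lemma agree_trans: "agree m f g \<Longrightarrow> agree m g h \<Longrightarrow> agree m f h"
  by (auto simp: agree_def)

section \<open>The quotient of order 16\<close>

text \<open>
  In terms of a word for \<open>f\<close>, \<open>lev f\<close> is the parity of the number of letters \<open>b, c\<close>, and \<open>pc f x\<close>
  that of the letters \<open>c, d\<close> with an even (\<open>x = False\<close>) or odd number of letters \<open>a\<close> to their right.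
\<close>

definition lev :: "(bool list \<Rightarrow> bool list) \<Rightarrow> bool" where
  "lev f = (swaps (sec f False) \<noteq> swaps (sec f True))"

definition pc :: "(bool list \<Rightarrow> bool list) \<Rightarrow> bool \<Rightarrow> bool" where
  "pc f x = (swaps (sec f x) \<noteq> lev (sec f (\<not> x)))"

text \<open>On \<open>grig\<close> this encodes a homomorphism onto (C_2 wr C_2) x C_2: by
  \<open>pc_comp\<close>, \<open>swaps\<close> permutes the two values of \<open>pc\<close>, while
  \<open>lev\<close> is a separate factor. The kernel turns out to be K.\<close>

definition sigma :: "(bool list \<Rightarrow> bool list) \<Rightarrow> bool \<times> bool \<times> bool \<times> bool" where
  "sigma f = (swaps f, pc f False, pc f True, lev f)"

lemma lev_comp: "f \<in> grig \<Longrightarrow> g \<in> grig \<Longrightarrow> lev (f \<circ> g) = (lev f \<noteq> lev g)"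
  by (cases "swaps g") (auto simp: lev_def sec_comp swaps_comp)

lemma pc_comp:
  "f \<in> grig \<Longrightarrow> g \<in> grig \<Longrightarrow> pc (f \<circ> g) x = (pc f (x \<noteq> swaps g) \<noteq> pc g x)"
  by (cases "swaps g"; cases x) (auto simp: pc_def sec_comp swaps_comp lev_comp)

lemma lev_simps [simp]: "lev id = False" "lev grig_a = False" "lev grig_b" "lev grig_c"
  "lev grig_d = False"
  by (simp_all add: lev_def)

lemma pc_simps [simp]: "pc id x = False" "pc grig_a x = False" "pc grig_b x = False"
  "pc grig_c x = (\<not> x)" "pc grig_d x = (\<not> x)"
  by (auto simp: pc_def)

lemma sigma_comp_cong:
  assumes "f \<in> grig" "f' \<in> grig" "g \<in> grig" "g' \<in> grig" "sigma f = sigma f'" "sigma g = sigma g'"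
  shows "sigma (f \<circ> g) = sigma (f' \<circ> g')"
  using assms by (cases "swaps g") (auto simp: sigma_def swaps_comp pc_comp lev_comp)

text \<open>\<open>swaps\<close> reads level 1, \<open>lev\<close> level 2 and \<open>pc\<close>
  level 3.\<close>

lemma agree_sigma:
  assumes "f \<in> grig" "g \<in> grig" "agree 3 f g"
  shows "sigma f = sigma g"
  using assms
  by (simp add: numeral_3_eq_3 agree_Suc sigma_def pc_def lev_def)

text \<open>A letter b or c that meets vertex 1 in the computation of one section contributes c or d
  there; in the other section it meets 0 and contributes a. So the parity of letters c, d in one
  section is that of letters a in the other.\<close>

lemma swaps_sec:
  assumes "f \<in> grig"
  shows "swaps (sec f (\<not> x)) \<longleftrightarrow> pc (sec f x) False \<noteq> pc (sec f x) True"
  using assms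
proof (induction arbitrary: x rule: grig_induct)
  case id
  show ?case by (simp only: sec_id swaps_id pc_simps) simp
next
  case (act l f)
  show ?case
    using act.IH[of x] act.hyps
    by (cases l; cases "swaps f"; cases x) (auto simp: sec_comp swaps_comp pc_comp simp del: comp_apply)
qed

lemma grig_bcd_mult [simp]:
  "grig_b (grig_c w) = grig_d w" "grig_c (grig_d w) = grig_b w" "grig_d (grig_b w) = grig_c w"
  by (induction w and w and w rule: grig_b_grig_c_grig_d.induct) (auto simp: grig_a_involution)

lemma grig_bcd_mult' [simp]:
  "grig_c (grig_b w) = grig_d w" "grig_d (grig_c w) = grig_b w" "grig_b (grig_d w) = grig_c w"
  by (metis grig_bcd_mult grig_bcd_involution)+

declare grig_a_involution [simp] grig_bcd_involution [simp]

section \<open>The subgroup K and its identification with the kernel of \<open>sigma\<close>\<close>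

definition grt :: "bool list \<Rightarrow> bool list" where
  "grt = grig_a \<circ> grig_b \<circ> grig_a \<circ> grig_b"

definition only :: "bool \<Rightarrow> (bool list \<Rightarrow> bool list) \<Rightarrow> bool list \<Rightarrow> bool list" where
  "only x f w = (case w of [] \<Rightarrow> [] | y # u \<Rightarrow> y # (if y = x then f u else u))"

text \<open>Products of conjugates of \<open>grt\<close> = abab already form its normal closure: the
  inverse baba is the conjugate of \<open>grt\<close> by a.\<close>

inductive_set KK :: "(bool list \<Rightarrow> bool list) set" where
  id: "id \<in> KK"
| conj: "f \<in> grig \<Longrightarrow> k \<in> KK \<Longrightarrow> f \<circ> grt \<circ> ginv f \<circ> k \<in> KK"

lemma grt_in_grig [simp]: "grt \<in> grig"
  by (simp add: grt_def)

lemma KK_in_grig: "k \<in> KK \<Longrightarrow> k \<in> grig"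
  by (induction rule: KK.induct) (simp_all del: id_apply comp_apply)

lemma grt_in_KK: "grt \<in> KK"
  using KK.conj[OF id_in_grig KK.id] by simp

lemma KK_comp: "k \<in> KK \<Longrightarrow> l \<in> KK \<Longrightarrow> k \<circ> l \<in> KK"
  by (induction rule: KK.induct) (auto simp: comp_assoc intro: KK.conj[unfolded comp_assoc])

lemma ginv_comp: "f \<in> grig \<Longrightarrow> g \<in> grig \<Longrightarrow> ginv (f \<circ> g) = ginv g \<circ> ginv f"
  by (simp add: o_inv_distrib grig_bij)

lemma KK_conj:
  assumes "s \<in> grig" "k \<in> KK"
  shows "s \<circ> k \<circ> ginv s \<in> KK"
  using assms(2)
proof (induction rule: KK.induct)
  case id
  have "s \<circ> id \<circ> ginv s \<in> KK" using assms(1) grig_inv[of s] KK.id by simp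
  then show ?case .
next
  case (conj f k)
  have "s \<circ> (f \<circ> grt \<circ> ginv f \<circ> k) \<circ> ginv s = (s \<circ> f) \<circ> grt \<circ> ginv (s \<circ> f) \<circ> (s \<circ> k \<circ> ginv s)"
    using assms(1) conj by (auto simp: ginv_comp grig_inv_app)
  then show ?case using KK.conj[OF comp_in_grig[OF assms(1) conj(1)] conj.IH] by (simp only:)
qed

lemma sigma_conj:
  assumes "s \<in> grig" "k \<in> grig" "sigma k = sigma id"
  shows "sigma (s \<circ> k \<circ> ginv s) = sigma id"
proof -
  have "sigma (s \<circ> k \<circ> ginv s) = sigma (s \<circ> id \<circ> ginv s)"
    by (intro sigma_comp_cong) (use assms in auto)
  then show ?thesis using assms(1) grig_inv(2)[of s] by simp
qed

lemma sigma_grt: "sigma grt = sigma id"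
  by (simp add: sigma_def grt_def swaps_comp pc_comp lev_comp)

lemma KK_sigma: "k \<in> KK \<Longrightarrow> sigma k = sigma id"
proof (induction rule: KK.induct)
  case id show ?case ..
next
  case (conj f k)
  have "sigma (f \<circ> grt \<circ> ginv f \<circ> k) = sigma (id \<circ> id)"
    by (intro sigma_comp_cong sigma_conj sigma_grt conj.IH) (use conj KK_in_grig in auto)
  then show ?case by (simp only: id_comp)
qed

text \<open>The dihedral group of order 8 generated by a and d. Together with its translate by b it
  represents the cosets of K.\<close>

definition dih :: "(bool list \<Rightarrow> bool list) set" where
  "dih = ev ` {[], [Ga], [Gd], [Ga, Gd], [Gd, Ga], [Ga, Gd, Ga], [Gd, Ga, Gd], [Ga, Gd, Ga, Gd]}"

text \<open>The elements ada = (b, 1) and d = (1, b) act on different subtrees, so they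
  commute.\<close>

lemma dada: "grig_d (grig_a (grig_d (grig_a w))) = grig_a (grig_d (grig_a (grig_d w)))"
  by (cases w rule: grig_a.cases) auto

lemma dih_closed:
  assumes "u \<in> dih" shows "grig_a \<circ> u \<in> dih" "grig_d \<circ> u \<in> dih"
proof -
  have *: "ev [Ga, Ga, Gd, Ga, Gd] = ev [Gd, Ga, Gd]" "ev [Gd, Ga, Gd, Ga] = ev [Ga, Gd, Ga, Gd]"
    "ev [Gd, Ga, Gd, Ga, Gd] = ev [Ga, Gd, Ga]"
    "ev [Ga, Ga] = ev []" "ev [Gd, Gd] = ev []" "ev [Ga, Ga, Gd] = ev [Gd]" "ev [Gd, Gd, Ga] = ev [Ga]"
    "ev [Ga, Ga, Gd, Ga] = ev [Gd, Ga]" "ev [Gd, Gd, Ga, Gd] = ev [Ga, Gd]"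
    by (auto simp: fun_eq_iff dada)
  from assms obtain w where
    w: "w \<in> {[], [Ga], [Gd], [Ga, Gd], [Gd, Ga], [Ga, Gd, Ga], [Gd, Ga, Gd], [Ga, Gd, Ga, Gd]}" "u = ev w"
    unfolding dih_def by blast
  have "ev (Ga # w) \<in> dih" "ev (Gd # w) \<in> dih"
    using w(1) by (auto simp only: insert_iff empty_iff *) (auto simp only: dih_def *)
  then show "grig_a \<circ> u \<in> dih" "grig_d \<circ> u \<in> dih"
    using w(2) by simp_all
qed

lemma dih_in_grig: "u \<in> dih \<Longrightarrow> u \<in> grig"
  by (auto simp: dih_def simp del: ev.simps)

text \<open>A new letter passes K by normality. It is then absorbed by the representative because bc
  = d and ab = \<open>grt\<close> ba, which moves a past b at the cost of an element of K.\<close>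

lemma grig_cosets:
  assumes "f \<in> grig"
  shows "\<exists>k\<in>KK. \<exists>u\<in>dih. f = k \<circ> u \<or> f = k \<circ> grig_b \<circ> u"
  using assms
proof (induction rule: grig_induct)
  case id
  have "id \<in> dih" by (auto simp: dih_def)
  then show ?case by (metis KK.id id_comp)
next
  case (act l f)
  then obtain k u r where k: "k \<in> KK" and u: "u \<in> dih" and r: "r \<in> {u, grig_b \<circ> u}" and f: "f = k \<circ> r"
    by (metis comp_assoc insertCI)
  have *: "\<exists>k'\<in>KK. \<exists>u'\<in>dih. act l \<circ> r = k' \<circ> u' \<or> act l \<circ> r = k' \<circ> grig_b \<circ> u'"
  proof (cases l)
    case Ga
    have "grig_a \<circ> (grig_b \<circ> u) = grt \<circ> grig_b \<circ> (grig_a \<circ> u)"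
      by (auto simp: grt_def)
    then show ?thesis using r Ga grt_in_KK KK.id dih_closed(1)[OF u]
      by (metis act.simps(1) id_comp insertE singletonD)
  next
    case Gb
    have "grig_b \<circ> (grig_b \<circ> u) = id \<circ> u" "grig_b \<circ> u = id \<circ> grig_b \<circ> u"
      by auto
    then show ?thesis using r Gb KK.id u
      by (metis act.simps(2) insertE singletonD)
  next
    case Gc
    have "grig_c \<circ> (grig_b \<circ> u) = id \<circ> (grig_d \<circ> u)" "grig_c \<circ> u = id \<circ> grig_b \<circ> (grig_d \<circ> u)"
      by auto
    then show ?thesis using r Gc KK.id dih_closed(2)[OF u]
      by (metis act.simps(3) insertE singletonD)
  next
    case Gd
    have "grig_d \<circ> (grig_b \<circ> u) = id \<circ> grig_b \<circ> (grig_d \<circ> u)" "grig_d \<circ> u = id \<circ> (grig_d \<circ> u)"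
      by auto
    then show ?thesis using r Gd KK.id dih_closed(2)[OF u]
      by (metis act.simps(4) insertE singletonD)
  qed
  then obtain k' u' where k': "k' \<in> KK" "u' \<in> dih" "act l \<circ> r = k' \<circ> u' \<or> act l \<circ> r = k' \<circ> grig_b \<circ> u'"
    by blast
  have "act l \<circ> f = (act l \<circ> k \<circ> ginv (act l)) \<circ> (act l \<circ> r)"
    using f by (auto simp: grig_inv_app)
  then have "act l \<circ> f = ((act l \<circ> k \<circ> ginv (act l)) \<circ> k') \<circ> u' \<or>
    act l \<circ> f = ((act l \<circ> k \<circ> ginv (act l)) \<circ> k') \<circ> grig_b \<circ> u'"
    using k'(3) by (metis comp_assoc)
  moreover have "(act l \<circ> k \<circ> ginv (act l)) \<circ> k' \<in> KK"
    by (intro KK_comp KK_conj k k') simp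
  ultimately show ?case using k'(2) by blast
qed

text \<open>Among the sixteen representatives from \<open>grig_cosets\<close> only the identity has
  trivial \<open>sigma\<close>.\<close>

lemma sigma_trivial_KK:
  assumes "f \<in> grig" "sigma f = sigma id"
  shows "f \<in> KK"
proof -
  obtain k u r where k: "k \<in> KK" and u: "u \<in> dih" and r: "r \<in> {u, grig_b \<circ> u}" and f: "f = k \<circ> r"
    using grig_cosets[OF assms(1)] by (metis comp_assoc insertCI)
  have rg: "r \<in> grig" using r dih_in_grig[OF u] by auto
  have "sigma (k \<circ> r) = sigma (id \<circ> r)"
    by (intro sigma_comp_cong) (use k rg KK_in_grig KK_sigma in auto)
  then have "sigma r = sigma id" using assms(2) f by simp
  then have "r = id"
    using u r unfolding dih_def
    by (auto simp: sigma_def swaps_comp pc_comp lev_comp)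
  then show ?thesis using f k by simp
qed

lemma sigma_eq_KK:
  assumes "f \<in> grig" "g \<in> grig" "sigma f = sigma g"
  shows "ginv f \<circ> g \<in> KK"
proof -
  have "sigma (ginv f \<circ> g) = sigma (ginv f \<circ> f)"
    by (intro sigma_comp_cong) (use assms in auto)
  then show ?thesis using assms sigma_trivial_KK grig_inv(1)[OF assms(1)] by simp
qed

section \<open>The branch structure\<close>

lemma only_Nil [simp]: "only x f [] = []"
  and only_Cons [simp]: "only x f (y # u) = y # (if y = x then f u else u)"
  by (simp_all add: only_def)

lemma swaps_only [simp]: "\<not> swaps (only x f)"
  by (simp add: swaps_def)

lemma sec_only [simp]: "sec (only x f) y = (if y = x then f else id)"
  by (auto simp: sec_def)

lemma only_comp: "only x (f \<circ> g) = only x f \<circ> only x g"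
proof
  fix w show "only x (f \<circ> g) w = (only x f \<circ> only x g) w"
    by (cases w) auto
qed

lemma only_id: "only x id = id"
proof
  fix w show "only x id w = id w"
    by (cases w) auto
qed

text \<open>Conjugation by \<open>s\<close> carries a copy at \<open>x\<close> to the image of
  \<open>x\<close> and conjugates it by the section of \<open>s\<close> there. The inverse of
  \<open>s\<close> is multiplied away.\<close>

lemma conj_only:
  assumes "s \<in> grig"
  shows "s \<circ> only x k = only (x \<noteq> swaps s) (sec s x \<circ> k \<circ> ginv (sec s x)) \<circ> s"
proof
  fix w show "(s \<circ> only x k) w = (only (x \<noteq> swaps s) (sec s x \<circ> k \<circ> ginv (sec s x)) \<circ> s) w"
    using assms by (cases w) (auto simp: grig_Nil grig_Cons grig_inv_app)
qed

lemma sec_surj: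
  assumes "f \<in> grig"
  shows "\<exists>s\<in>grig. \<not> swaps s \<and> sec s x = f"
  using assms
proof (induction rule: grig_induct)
  case id
  show ?case by (rule bexI[of _ id]) (simp_all del: id_apply)
next
  case (act l f)
  then obtain s where s: "s \<in> grig" "\<not> swaps s" "sec s x = f" by blast
  \<comment> \<open>As b = (a, c), c = (a, d) and d = (1, b), the elements aba, d, b, c have
    sections a, b, c, d at 1. Conjugation by a exchanges the two coordinates.\<close>
  define r where "r = (if x
    then (case l of Ga \<Rightarrow> grig_a \<circ> grig_b \<circ> grig_a | Gb \<Rightarrow> grig_d | Gc \<Rightarrow> grig_b | Gd \<Rightarrow> grig_c)
    else (case l of Ga \<Rightarrow> grig_b | Gb \<Rightarrow> grig_a \<circ> grig_d \<circ> grig_a | Gc \<Rightarrow> grig_a \<circ> grig_b \<circ> grig_a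
                  | Gd \<Rightarrow> grig_a \<circ> grig_c \<circ> grig_a))"
  have "r \<in> grig" "\<not> swaps r" "sec r x = act l"
    by (cases l; cases x; simp add: r_def swaps_comp sec_comp)+
  then show ?case
    using s by (intro bexI[of _ "r \<circ> s"]) (simp_all add: swaps_comp sec_comp del: comp_apply)
qed

text \<open>With \<open>grt\<close> = (ca, ac) and c = (a, d) the first coordinate is caacaa = 1 and
  the second is acdacd = abab. The right side is \<open>grt\<close> times a conjugate of
  \<open>grt\<close>, hence in K.\<close>

lemma only_True_grt: "only True grt = grt \<circ> grig_c \<circ> grt \<circ> grig_c"
proof
  fix w show "only True grt w = (grt \<circ> grig_c \<circ> grt \<circ> grig_c) w"
    by (cases w rule: grig_a.cases) (auto simp: grt_def)
qed

text \<open>This expresses (1, \<open>grt\<close>) as the commutator of \<open>grt\<close> and d: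
  the first coordinate cancels, the second is (ac)b(ca)b = abab.\<close>

lemma grt_commutator: "only True grt \<circ> (grig_d \<circ> grt) = grt \<circ> grig_d"
proof
  fix w show "(only True grt \<circ> (grig_d \<circ> grt)) w = (grt \<circ> grig_d) w"
    by (cases w rule: grig_a.cases) (auto simp: grt_def)
qed

lemma KK_conjI: "s \<in> grig \<Longrightarrow> k \<in> KK \<Longrightarrow> s \<circ> k = k' \<circ> s \<Longrightarrow> k' \<in> KK"
  by (metis KK_conj comp_assoc comp_id grig_inv(2))

lemma only_grt_KK: "only x grt \<in> KK"
proof -
  have c: "ginv grig_c = grig_c"
    by (rule inv_unique_comp) auto
  have *: "only True grt \<in> KK"
    unfolding only_True_grt using KK_comp[OF grt_in_KK KK_conj[OF gens_in_grig(3) grt_in_KK]]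
    by (simp add: c comp_assoc)
  moreover have "only False grt \<in> KK"
    by (rule KK_conjI[OF gens_in_grig(1) *]) (simp add: conj_only inv_id)
  ultimately show ?thesis by (cases x) auto
qed

text \<open>K x K \<le> K: by \<open>sec_surj\<close> the conjugator \<open>f\<close> is a section
  at \<open>x\<close> of some \<open>s\<close> fixing the first level, and conjugating the copy of
  \<open>grt\<close> at \<open>x\<close> by \<open>s\<close> conjugates \<open>grt\<close> by
  \<open>f\<close>.\<close>

lemma only_KK:
  assumes "k \<in> KK" shows "only x k \<in> KK"
  using assms
proof (induction rule: KK.induct)
  case id
  show ?case unfolding only_id by (rule KK.id)
next
  case (conj f k)
  obtain s where s: "s \<in> grig" "\<not> swaps s" "sec s x = f"
    using sec_surj[OF conj(1)] by blast
  have "only x (f \<circ> grt \<circ> ginv f) \<in> KK"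
    using conj_only[OF s(1), of x grt] s by (intro KK_conjI[OF s(1) only_grt_KK[of x]]) simp
  then show ?case unfolding only_comp[of x "f \<circ> grt \<circ> ginv f"]
    using conj.IH by (rule KK_comp)
qed

definition mk :: "bool \<Rightarrow> (bool \<Rightarrow> bool list \<Rightarrow> bool list) \<Rightarrow> bool list \<Rightarrow> bool list" where
  "mk e F w = (case w of [] \<Rightarrow> [] | y # u \<Rightarrow> (y \<noteq> e) # F y u)"

lemma swaps_mk [simp]: "swaps (mk e F) = e" if "F False [] = []"
  using that by (simp add: swaps_def mk_def)

lemma sec_mk [simp]: "sec (mk e F) x = F x"
  by (auto simp: sec_def mk_def)

text \<open>The new sections differ from those of \<open>f\<close> by elements of K, and copies of
  these at the two vertices lie in the group. This is what allows corrected sections to be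
  glued.\<close>

lemma mk_in_grig:
  assumes "f \<in> grig" "\<And>x. F x \<in> grig" "\<And>x. sigma (F x) = sigma (sec f x)"
  shows "mk (swaps f) F \<in> grig"
proof -
  let ?k = "\<lambda>x. ginv (sec f x) \<circ> F x"
  have "?k x \<in> KK" for x
    by (rule sigma_eq_KK) (use assms in auto)
  then have "f \<circ> only False (?k False) \<circ> only True (?k True) \<in> grig"
    using assms(1) by (intro comp_in_grig KK_in_grig[OF only_KK])
  moreover have "f \<circ> only False (?k False) \<circ> only True (?k True) = mk (swaps f) F"
  proof
    fix w show "(f \<circ> only False (?k False) \<circ> only True (?k True)) w = mk (swaps f) F w"
      using assms(1) by (cases w rule: grig_a.cases) (auto simp: mk_def grig_Nil grig_Cons grig_inv_app)
  qed
  ultimately show ?thesis by simp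
qed

section \<open>Lifting approximate conjugators\<close>

text \<open>Congruence modulo the product of the copies of K at level \<open>n\<close>. It lies
  between \<open>agree n\<close> and \<open>agree (n + 3)\<close> and, unlike these, is preserved
  exactly by gluing with \<open>mk\<close>.\<close>

fun sim :: "nat \<Rightarrow> (bool list \<Rightarrow> bool list) \<Rightarrow> (bool list \<Rightarrow> bool list) \<Rightarrow> bool" where
  "sim 0 f g \<longleftrightarrow> sigma f = sigma g"
| "sim (Suc n) f g \<longleftrightarrow> swaps f = swaps g \<and> (\<forall>x. sim n (sec f x) (sec g x))"

lemma sim_refl: "sim n f f"
  by (induction n arbitrary: f) auto

lemma sim_trans: "sim n f g \<Longrightarrow> sim n g h \<Longrightarrow> sim n f h"
proof (induction n arbitrary: f g h)
  case (Suc n)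
  then show ?case unfolding sim.simps by blast
qed simp

lemma sim_comp:
  assumes "f \<in> grig" "f' \<in> grig" "g \<in> grig" "g' \<in> grig" "sim n f f'" "sim n g g'"
  shows "sim n (f \<circ> g) (f' \<circ> g')"
  using assms
proof (induction n arbitrary: f f' g g')
  case 0
  then show ?case unfolding sim.simps by (intro sigma_comp_cong)
next
  case (Suc n)
  then show ?case by (simp add: swaps_comp sec_comp del: comp_apply)
qed

text \<open>\<open>sigma f\<close> is determined by \<open>swaps f\<close> and the values of
  \<open>sigma\<close> at the two sections.\<close>

lemma sim_sigma: "sim n f g \<Longrightarrow> sigma f = sigma g"
proof (induction n arbitrary: f g)
  case (Suc n)
  then have "swaps f = swaps g" "\<And>x. sigma (sec f x) = sigma (sec g x)" by auto
  then show ?case by (simp add: sigma_def pc_def lev_def[of f] lev_def[of g])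
qed simp

lemma agree_sim:
  "f \<in> grig \<Longrightarrow> g \<in> grig \<Longrightarrow> agree (n + 3) f g \<Longrightarrow> sim n f g"
proof (induction n arbitrary: f g)
  case 0
  then show ?case using agree_sigma by simp
next
  case (Suc n)
  have "agree (Suc (n + 3)) f g" using Suc.prems(3) by simp
  then show ?case using Suc by (simp only: agree_Suc sim.simps sec_in_grig simp_thms)
qed

lemma sim_agree: "f \<in> grig \<Longrightarrow> g \<in> grig \<Longrightarrow> sim n f g \<Longrightarrow> agree n f g"
proof (induction n arbitrary: f g)
  case 0
  then show ?case by (auto simp: agree_def grig_Nil)
qed (simp add: agree_Suc)

text \<open>\<open>m\<close> is the precision of the given conjugator, \<open>n\<close> that of its
  correction. Centralisers are the case \<open>g = h\<close>; two elements are needed because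
  \<open>f\<close> may match different sections of one element.\<close>

definition lifts_at :: "nat \<Rightarrow> nat \<Rightarrow> (bool list \<Rightarrow> bool list) \<Rightarrow> (bool list \<Rightarrow> bool list) \<Rightarrow> bool" where
  "lifts_at m n g h \<longleftrightarrow>
    (\<forall>f\<in>grig. agree m (g \<circ> f) (f \<circ> h) \<longrightarrow> (\<exists>f'\<in>grig. sim n f' f \<and> g \<circ> f' = f' \<circ> h))"

definition lifts :: "nat \<Rightarrow> (bool list \<Rightarrow> bool list) \<Rightarrow> (bool list \<Rightarrow> bool list) \<Rightarrow> bool" where
  "lifts n g h \<longleftrightarrow> (\<exists>m. lifts_at m n g h)"

lemma lifts_at_mono: "lifts_at m n g h \<Longrightarrow> m \<le> m' \<Longrightarrow> lifts_at m' n g h"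
  unfolding lifts_at_def using agree_mono by blast

text \<open>The precision has to be chosen before \<open>f\<close> is given, hence before it is
  known which sections \<open>f\<close> matches.\<close>

lemma lifts_uniform:
  fixes G H :: "bool \<Rightarrow> bool \<Rightarrow> bool list \<Rightarrow> bool list"
  assumes "\<And>x y. lifts n (G x y) (H x y)"
  obtains m where "m \<ge> k" "\<And>x y. lifts_at m n (G x y) (H x y)"
proof -
  obtain m where m: "\<And>x y. lifts_at (m x y) n (G x y) (H x y)"
    using assms unfolding lifts_def by metis
  let ?m = "k + m True True + m True False + m False True + m False False"
  have "m x y \<le> ?m" for x y
    by (cases x; cases y) auto
  then have "lifts_at ?m n (G x y) (H x y)" for x y
    using m lifts_at_mono by blast
  then show ?thesis by (intro that[of ?m]) simp_all
qed

text \<open>The two sections of \<open>f\<close> are approximate conjugators independent of each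
  other. They are corrected separately, within their cosets of K, and glued.\<close>

lemma lifts_Suc_fixing:
  assumes gh: "g \<in> grig" "h \<in> grig" "\<not> swaps g" "\<not> swaps h"
    and L: "\<And>x y. lifts n (sec g y) (sec h x)"
  shows "lifts (Suc n) g h"
proof -
  obtain m where m: "\<And>x y. lifts_at m n (sec g y) (sec h x)"
    by (rule lifts_uniform[of n "\<lambda>x y. sec g y" "\<lambda>x y. sec h x" 0]) (rule L, blast)
  have "lifts_at (Suc m) (Suc n) g h"
    unfolding lifts_at_def
  proof (intro ballI impI)
    fix f assume f: "f \<in> grig" and a: "agree (Suc m) (g \<circ> f) (f \<circ> h)"
    have "\<exists>f'\<in>grig. sim n f' (sec f x) \<and> sec g (x \<noteq> swaps f) \<circ> f' = f' \<circ> sec h x" for x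
    proof -
      have "agree m (sec (g \<circ> f) x) (sec (f \<circ> h) x)"
        using a f gh by (simp add: agree_Suc del: comp_apply)
      then show ?thesis
        using m[of "x \<noteq> swaps f" x] f gh unfolding lifts_at_def by (simp add: sec_comp del: comp_apply)
    qed
    then obtain F where F: "F x \<in> grig" "sim n (F x) (sec f x)"
      "sec g (x \<noteq> swaps f) \<circ> F x = F x \<circ> sec h x" for x by metis
    let ?f' = "mk (swaps f) F"
    have f': "?f' \<in> grig"
      using f F(1) sim_sigma[OF F(2)] by (rule mk_in_grig)
    have s: "swaps ?f' = swaps f" using F(1) grig_Nil by simp
    have "g \<circ> ?f' = ?f' \<circ> h"
      by (rule grig_eqI) (use gh f' F(3) s in \<open>simp_all add: swaps_comp sec_comp del: comp_apply\<close>)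
    then show "\<exists>f'\<in>grig. sim (Suc n) f' f \<and> g \<circ> f' = f' \<circ> h"
      using f' F(2) s by auto
  qed
  then show ?thesis unfolding lifts_def ..
qed

text \<open>The relation at \<open>False\<close> determines the section of \<open>f\<close> at
  \<open>True\<close> from the one at \<open>False\<close>; substituted into the other relation, it
  leaves one condition on the section at \<open>False\<close>.\<close>

lemma lifts_Suc_swapping:
  assumes gh: "g \<in> grig" "h \<in> grig" "swaps g" "swaps h"
    and L: "\<And>y. lifts n (sec g (\<not> y) \<circ> sec g y) (sec h True \<circ> sec h False)"
  shows "lifts (Suc n) g h"
proof -
  \<comment> \<open>The three extra levels turn agreement into \<open>sim n\<close> for the section
    at \<open>True\<close>, by \<open>agree_sim\<close>.\<close>
  obtain m where mk: "m \<ge> n + 3"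
    and m: "\<And>y. lifts_at m n (sec g (\<not> y) \<circ> sec g y) (sec h True \<circ> sec h False)"
    by (rule lifts_uniform[of n "\<lambda>x y. sec g (\<not> y) \<circ> sec g y" "\<lambda>x y. sec h True \<circ> sec h False" "n + 3"])
      (rule L, blast)
  have "lifts_at (Suc m) (Suc n) g h"
    unfolding lifts_at_def
  proof (intro ballI impI)
    fix f assume f: "f \<in> grig" and a: "agree (Suc m) (g \<circ> f) (f \<circ> h)"
    define y where "y = swaps f"
    have a': "agree m (sec (g \<circ> f) x) (sec (f \<circ> h) x)" for x
      using a f gh by (simp add: agree_Suc del: comp_apply)
    have a0: "agree m (sec g y \<circ> sec f False) (sec f True \<circ> sec h False)"
      using a'[of False] f gh by (simp add: sec_comp y_def del: comp_apply)
    have a1: "agree m (sec g (\<not> y) \<circ> sec f True) (sec f False \<circ> sec h True)"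
      using a'[of True] f gh by (simp add: sec_comp y_def del: comp_apply)
    have "agree m (sec g (\<not> y) \<circ> (sec g y \<circ> sec f False)) (sec g (\<not> y) \<circ> (sec f True \<circ> sec h False))"
      by (rule agree_comp_left[OF a0])
    moreover have "agree m ((sec g (\<not> y) \<circ> sec f True) \<circ> sec h False) ((sec f False \<circ> sec h True) \<circ> sec h False)"
      by (rule agree_comp_right[OF a1]) (use gh in simp)
    ultimately have "agree m ((sec g (\<not> y) \<circ> sec g y) \<circ> sec f False) (sec f False \<circ> (sec h True \<circ> sec h False))"
      unfolding comp_assoc by (rule agree_trans)
    then obtain f0 where f0: "f0 \<in> grig" "sim n f0 (sec f False)"
      "(sec g (\<not> y) \<circ> sec g y) \<circ> f0 = f0 \<circ> (sec h True \<circ> sec h False)"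
      using m[of y] sec_in_grig[OF f] unfolding lifts_at_def by blast
    define i where "i = ginv (sec h False)"
    have i: "i \<in> grig" "sec h False \<circ> i = id" "i \<circ> sec h False = id"
      using gh grig_inv[of "sec h False"] by (simp_all add: i_def)
    \<comment> \<open>The exact relation at \<open>False\<close> forces this value; the one at
      \<open>True\<close> then follows from the equation for \<open>f0\<close>.\<close>
    define f1 where "f1 = sec g y \<circ> f0 \<circ> i"
    have f1: "f1 \<in> grig" using gh f0 i by (simp add: f1_def del: comp_apply)
    have "agree m (sec g y \<circ> sec f False \<circ> i) (sec f True \<circ> sec h False \<circ> i)"
      by (rule agree_comp_right[OF a0 i(1)])
    then have "agree (n + 3) (sec g y \<circ> sec f False \<circ> i) (sec f True)"
      using mk i(2) by (simp add: comp_assoc agree_mono del: comp_apply)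
    then have "sim n (sec g y \<circ> sec f False \<circ> i) (sec f True)"
      by (rule agree_sim[rotated 2]) (use gh f i in \<open>simp_all del: comp_apply\<close>)
    moreover have "sim n f1 (sec g y \<circ> sec f False \<circ> i)"
      unfolding f1_def by (intro sim_comp sim_refl f0) (use gh f i f0 in \<open>simp_all del: comp_apply\<close>)
    ultimately have s1: "sim n f1 (sec f True)" by (rule sim_trans[rotated])
    have e0: "f1 \<circ> sec h False = sec g y \<circ> f0"
      unfolding f1_def by (simp add: comp_assoc i del: comp_apply)
    have e1: "sec g (\<not> y) \<circ> f1 = f0 \<circ> sec h True"
    proof -
      have "sec g (\<not> y) \<circ> f1 = (sec g (\<not> y) \<circ> sec g y) \<circ> f0 \<circ> i"
        by (simp add: f1_def comp_assoc del: comp_apply)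
      also have "\<dots> = f0 \<circ> sec h True \<circ> (sec h False \<circ> i)"
        unfolding f0(3) by (simp only: comp_assoc)
      finally show ?thesis using i by simp
    qed
    define F where "F x = (if x then f1 else f0)" for x
    have F: "F x \<in> grig" "sim n (F x) (sec f x)" for x
      using f0 f1 s1 by (auto simp: F_def)
    let ?f' = "mk (swaps f) F"
    have f': "?f' \<in> grig"
      using f F(1) sim_sigma[OF F(2)] by (rule mk_in_grig)
    have s: "swaps ?f' = y" using F(1) grig_Nil by (simp add: y_def)
    have "g \<circ> ?f' = ?f' \<circ> h"
    proof (rule grig_eqI)
      fix x
      show "sec (g \<circ> ?f') x = sec (?f' \<circ> h) x"
        using gh f' s e0 e1 by (cases x) (simp_all add: sec_comp F_def del: comp_apply)
    qed (use gh f' s in \<open>simp_all add: swaps_comp del: comp_apply\<close>)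
    then show "\<exists>f'\<in>grig. sim (Suc n) f' f \<and> g \<circ> f' = f' \<circ> h"
      using f' F(2) s y_def by auto
  qed
  then show ?thesis unfolding lifts_def ..
qed

text \<open>Vacuous: \<open>swaps\<close> is a homomorphism to an abelian group, so no
  \<open>f\<close> conjugates even on the first level.\<close>

lemma lifts_swaps_neq:
  assumes "g \<in> grig" "h \<in> grig" "swaps g \<noteq> swaps h"
  shows "lifts n g h"
proof -
  have "lifts_at 1 n g h"
    using assms by (auto simp: lifts_at_def agree_Suc swaps_comp simp del: comp_apply)
  then show ?thesis unfolding lifts_def ..
qed

text \<open>The section steps raise \<open>n\<close> by one; the weight induction for
  \<open>n = 0\<close> drops back by this.\<close>

lemma lifts_Suc_imp_0: "lifts (Suc n) g h \<Longrightarrow> lifts 0 g h"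
  unfolding lifts_def lifts_at_def sim.simps(1) using sim_sigma by meson

text \<open>Multiplying \<open>f\<close> on the left by the inverse of \<open>s\<close> turns
  conjugators for \<open>g\<close> into conjugators for \<open>g'\<close> and keeps both
  approximations.\<close>

lemma lifts_conj_left:
  assumes "s \<in> grig" "g \<in> grig" "s \<circ> g' = g \<circ> s" "lifts n g' h"
  shows "lifts n g h"
proof -
  obtain m where m: "lifts_at m n g' h" using assms(4) unfolding lifts_def ..
  have "lifts_at m n g h" unfolding lifts_at_def
  proof (intro ballI impI)
    fix f assume f: "f \<in> grig" and a: "agree m (g \<circ> f) (f \<circ> h)"
    have "ginv s \<circ> (g \<circ> f) = g' \<circ> (ginv s \<circ> f)"
    proof
      fix w
      have "s (g' (ginv s (f w))) = g (s (ginv s (f w)))"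
        using assms(3) by (metis comp_apply)
      then show "(ginv s \<circ> (g \<circ> f)) w = (g' \<circ> (ginv s \<circ> f)) w"
        using assms(1) by (metis comp_apply grig_inv_app)
    qed
    then have "agree m (g' \<circ> (ginv s \<circ> f)) ((ginv s \<circ> f) \<circ> h)"
      using agree_comp_left[OF a, of "ginv s"] by (simp add: comp_assoc)
    then obtain f1 where f1: "f1 \<in> grig" "sim n f1 (ginv s \<circ> f)" "g' \<circ> f1 = f1 \<circ> h"
      using m f assms(1) unfolding lifts_at_def by (meson comp_in_grig inv_in_grig)
    have "sim n (s \<circ> f1) (s \<circ> (ginv s \<circ> f))"
      by (intro sim_comp sim_refl f1) (use assms f in \<open>simp_all del: comp_apply\<close>)
    moreover have "s \<circ> (ginv s \<circ> f) = f"
      using assms(1) by (auto simp: grig_inv_app)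
    moreover have "g \<circ> (s \<circ> f1) = (s \<circ> f1) \<circ> h"
      using assms(3) f1(3) by (metis comp_assoc)
    ultimately show "\<exists>f'\<in>grig. sim n f' f \<and> g \<circ> f' = f' \<circ> h"
      using assms(1) f1(1) by (metis comp_in_grig)
  qed
  then show ?thesis unfolding lifts_def ..
qed

lemma lifts_conj_right:
  assumes "s \<in> grig" "h \<in> grig" "s \<circ> h' = h \<circ> s" "lifts n g h'"
  shows "lifts n g h"
proof -
  obtain m where m: "lifts_at m n g h'" using assms(4) unfolding lifts_def ..
  have "lifts_at m n g h" unfolding lifts_at_def
  proof (intro ballI impI)
    fix f assume f: "f \<in> grig" and a: "agree m (g \<circ> f) (f \<circ> h)"
    have "agree m (g \<circ> (f \<circ> s)) ((f \<circ> s) \<circ> h')"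
      using agree_comp_right[OF a assms(1)] assms(3) by (simp add: comp_assoc)
    then obtain f1 where f1: "f1 \<in> grig" "sim n f1 (f \<circ> s)" "g \<circ> f1 = f1 \<circ> h'"
      using m f assms(1) unfolding lifts_at_def by (meson comp_in_grig)
    have "sim n (f1 \<circ> ginv s) ((f \<circ> s) \<circ> ginv s)"
      by (intro sim_comp sim_refl f1) (use assms f in \<open>simp_all del: comp_apply\<close>)
    moreover have "(f \<circ> s) \<circ> ginv s = f"
      using assms(1) by (auto simp: grig_inv_app)
    moreover have "h' \<circ> ginv s = ginv s \<circ> h"
      using assms(1,3) by (metis comp_assoc comp_id grig_inv id_comp)
    then have "g \<circ> (f1 \<circ> ginv s) = (f1 \<circ> ginv s) \<circ> h"
      using f1(3) by (metis comp_assoc)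
    ultimately show "\<exists>f'\<in>grig. sim n f' f \<and> g \<circ> f' = f' \<circ> h"
      using assms(1) f1(1) by (metis comp_in_grig inv_in_grig)
  qed
  then show ?thesis unfolding lifts_def ..
qed

section \<open>The base case: pairs of elements of {1, b, c, d}\<close>

text \<open>
  Modulo \<open>KK\<close>, the elements almost commuting with \<open>b\<close> or with \<open>c\<close> are \<open>1, b, c, d\<close>; those almost
  commuting with \<open>d\<close> are generated by these and \<open>a d a\<close>.
\<close>

lemma agree_sec:
  assumes "f \<in> grig" "g \<in> grig" "agree (Suc m) f g"
  shows "agree m (sec f x) (sec g x)"
  using assms by (simp add: agree_Suc)

text \<open>The two sections of \<open>f\<close> agree on three levels, hence have the same
  \<open>sigma\<close>.\<close>

lemma commutes_a_sigma:
  assumes "f \<in> grig" "agree 4 (grig_a \<circ> f) (f \<circ> grig_a)"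
  shows "\<not> lev f" "pc f True = pc f False"
proof -
  have "agree 3 (sec (grig_a \<circ> f) False) (sec (f \<circ> grig_a) False)"
    using assms by (intro agree_sec) (simp_all del: comp_apply)
  then have "agree 3 (sec f False) (sec f True)"
    using assms(1) by (simp add: sec_comp del: comp_apply)
  then have "sigma (sec f False) = sigma (sec f True)"
    using assms(1) by (intro agree_sigma) simp_all
  then show "\<not> lev f" "pc f True = pc f False"
    by (auto simp: sigma_def lev_def pc_def)
qed

text \<open>If \<open>f\<close> swapped, it would nearly conjugate a to c or d, which do not swap.
  So its section at 0 nearly commutes with a, and \<open>swaps_sec\<close> converts this into a
  statement on the section at 1.\<close>

lemma commutes_bc_sigma:
  assumes g: "g \<in> {grig_b, grig_c}" and f: "f \<in> grig" and a: "agree 5 (g \<circ> f) (f \<circ> g)"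
  shows "\<not> swaps f" "\<not> pc f True"
proof -
  have gg: "g \<in> grig" "\<not> swaps g" "sec g False = grig_a" "\<not> swaps (sec g True)" using g by auto
  have a': "agree 4 (sec (g \<circ> f) False) (sec (f \<circ> g) False)"
    using a f gg by (intro agree_sec) (simp_all del: comp_apply)
  show s: "\<not> swaps f"
  proof
    assume "swaps f"
    then have "agree 4 (sec g True \<circ> sec f False) (sec f False \<circ> grig_a)"
      using a' f gg by (simp add: sec_comp del: comp_apply)
    then have "swaps (sec g True \<circ> sec f False) = swaps (sec f False \<circ> grig_a)"
      by (simp add: agree_def swaps_def)
    then show False using f gg by (simp add: swaps_comp del: comp_apply)
  qed
  have "agree 4 (grig_a \<circ> sec f False) (sec f False \<circ> grig_a)"
    using a' f gg s by (simp add: sec_comp del: comp_apply)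
  from commutes_a_sigma[OF _ this] show "\<not> pc f True"
    using swaps_sec[OF f, of False] f by (simp add: pc_def[of f])
qed

text \<open>As d = (1, b), a swapping \<open>f\<close> would make b trivial modulo K, but
  \<open>lev\<close> detects b.\<close>

lemma commutes_d_swaps:
  assumes f: "f \<in> grig" and a: "agree 4 (grig_d \<circ> f) (f \<circ> grig_d)"
  shows "\<not> swaps f"
proof
  assume "swaps f"
  have "agree 3 (sec (grig_d \<circ> f) False) (sec (f \<circ> grig_d) False)"
    using a f by (intro agree_sec) (simp_all del: comp_apply)
  then have "agree 3 (grig_b \<circ> sec f False) (sec f False)"
    using f \<open>swaps f\<close> by (simp add: sec_comp del: comp_apply)
  then have "sigma (grig_b \<circ> sec f False) = sigma (sec f False)"
    using f by (intro agree_sigma) (simp_all del: comp_apply)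
  then show False
    using f by (simp add: sigma_def lev_comp del: comp_apply)
qed

text \<open>Different letters are not even conjugate modulo K, so the claim is vacuous. For equal
  ones, each value of \<open>sigma\<close> that \<open>f\<close> can have is attained by an element
  commuting exactly with the letter.\<close>

lemma lifts_letters:
  assumes "u \<in> {id, grig_b, grig_c, grig_d}" "v \<in> {id, grig_b, grig_c, grig_d}"
  shows "lifts 0 u v"
proof (cases "u = v")
  case False
  have uv: "u \<in> grig" "v \<in> grig" using assms by auto
  have nu: "\<not> swaps u" "\<not> pc u True" and nv: "\<not> swaps v" "\<not> pc v True"
    using assms by (auto simp del: id_apply)
  have "lifts_at 3 0 u v" unfolding lifts_at_def
  proof (intro ballI impI)
    fix f assume f: "f \<in> grig" and a: "agree 3 (u \<circ> f) (f \<circ> v)"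
    have "sigma (u \<circ> f) = sigma (f \<circ> v)"
      by (rule agree_sigma[OF _ _ a]) (use f uv in \<open>simp_all del: comp_apply\<close>)
    then have e: "lev (u \<circ> f) = lev (f \<circ> v)" "pc (u \<circ> f) x = pc (f \<circ> v) x" for x
      unfolding sigma_def by (cases x; simp)+
    have l: "lev u = lev v"
      using e(1) f uv lev_comp by blast
    have p: "pc u (x \<noteq> swaps f) = pc v x" for x
      using e(2)[of x] nv(1) unfolding pc_comp[OF uv(1) f] pc_comp[OF f uv(2)]
      by (cases "pc f x") simp_all
    have "pc u False = pc v False"
      using p[of False] p[of True] nu nv by (cases "swaps f") simp_all
    then have "sigma u = sigma v"
      using l nu nv by (simp add: sigma_def)
    then show "\<exists>f'\<in>grig. sim 0 f' f \<and> u \<circ> f' = f' \<circ> v"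
      using assms False nu nv by (elim insertE emptyE) (simp_all add: sigma_def)
  qed
  then show ?thesis unfolding lifts_def ..
next
  case True
  have E: "\<exists>f'\<in>{id, grig_b, grig_c, grig_d}. sigma f' = (False, p, False, r)" for p r
    by (cases p; cases r) (simp_all add: sigma_def)
  show ?thesis
  proof (cases "u = id")
    case True
    then have "lifts_at 0 0 u v" using \<open>u = v\<close>
      by (auto simp: lifts_at_def)
    then show ?thesis unfolding lifts_def ..
  next
    case False
    have "lifts_at 5 0 u v" unfolding lifts_at_def
    proof (intro ballI impI)
      fix f assume f: "f \<in> grig" and a: "agree 5 (u \<circ> f) (f \<circ> v)"
      show "\<exists>f'\<in>grig. sim 0 f' f \<and> u \<circ> f' = f' \<circ> v"
      proof (cases "u = grig_d")
        case False
        then have u: "u \<in> {grig_b, grig_c}" using assms \<open>u \<noteq> id\<close> by auto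
        obtain f' where f': "f' \<in> {id, grig_b, grig_c, grig_d}"
          "sigma f' = (False, pc f False, False, lev f)" using E by blast
        then have "sigma f' = sigma f"
          using commutes_bc_sigma[OF u f] a \<open>u = v\<close> by (simp add: sigma_def)
        moreover have "u \<circ> f' = f' \<circ> v"
          using u f'(1) \<open>u = v\<close> by auto
        moreover have "f' \<in> grig" using f'(1) by auto
        ultimately show ?thesis by auto
      next
        case True
        have s: "\<not> swaps f"
          using a True \<open>u = v\<close> by (intro commutes_d_swaps f) (auto intro: agree_mono)
        obtain f' where f': "f' \<in> {id, grig_b, grig_c, grig_d}"
          "sigma f' = (False, pc f False, False, lev f)" using E by blast
        \<comment> \<open>The element ada commutes with d by \<open>dada\<close> and supplies the
          coordinate \<open>pc f True\<close>, which vanishes on 1, b, c, d.\<close>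
        define z where "z = (if pc f True then grig_a \<circ> grig_d \<circ> grig_a else id)"
        have z: "z \<in> grig" "sigma z = (False, False, pc f True, False)"
          by (simp_all add: z_def sigma_def swaps_comp pc_comp lev_comp del: comp_apply)
        have f'g: "f' \<in> grig" using f'(1) by auto
        have "sigma (f' \<circ> z) = sigma f"
          using f' z f'g s by (simp add: sigma_def swaps_comp pc_comp lev_comp del: comp_apply)
        moreover have "u \<circ> (f' \<circ> z) = (f' \<circ> z) \<circ> v"
        proof -
          have "grig_d \<circ> f' = f' \<circ> grig_d" using f'(1) by auto
          moreover have "grig_d \<circ> z = z \<circ> grig_d"
            by (auto simp: z_def dada)
          ultimately show ?thesis using True \<open>u = v\<close> by (metis comp_assoc)
        qed
        ultimately show ?thesis using f'g z(1) by (metis comp_in_grig sim.simps(1))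
      qed
    qed
    then show ?thesis unfolding lifts_def ..
  qed
qed

section \<open>Cyclically reduced words\<close>

text \<open>
  The weights are chosen so that \<open>b \<mapsto> (a, c)\<close>, \<open>c \<mapsto> (a, d)\<close>, \<open>d \<mapsto> (1, b)\<close> all decrease the weight
  of \<open>a x\<close>, while merging two letters among \<open>b, c, d\<close> does not increase it.
\<close>

fun wt :: "gen \<Rightarrow> nat" where
  "wt Ga = 3" | "wt Gb = 4" | "wt Gc = 3" | "wt Gd = 2"

definition wtw :: "gen list \<Rightarrow> nat" where "wtw w = sum_list (map wt w)"

fun alt :: "gen list \<Rightarrow> gen list" where
  "alt [] = []" | "alt (x # xs) = Ga # x # alt xs"

fun red :: "gen list \<Rightarrow> bool" where
  "red [] = True"
| "red [x] = True"
| "red (x # y # w) = ((x = Ga) \<noteq> (y = Ga) \<and> red (y # w))"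

definition third :: "gen \<Rightarrow> gen \<Rightarrow> gen" where
  "third x y = (if Gb \<notin> {x, y} then Gb else if Gc \<notin> {x, y} then Gc else Gd)"

definition conj_to :: "gen list \<Rightarrow> gen list \<Rightarrow> bool" where
  "conj_to w r \<longleftrightarrow> (\<exists>s\<in>grig. s \<circ> ev r = ev w \<circ> s)"

text \<open>Cyclically reduced words, rotated to begin with \<open>Ga\<close> when longer than one
  letter.\<close>

definition nform :: "gen list \<Rightarrow> bool" where
  "nform r \<longleftrightarrow> length r \<le> 1 \<or> (\<exists>xs. xs \<noteq> [] \<and> Ga \<notin> set xs \<and> r = alt xs)"

lemma wtw_simps [simp]: "wtw [] = 0" "wtw (x # w) = wt x + wtw w" "wtw (u @ v) = wtw u + wtw v"
  by (simp_all add: wtw_def)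

lemma third:
  assumes "x \<noteq> y" "x \<noteq> Ga" "y \<noteq> Ga"
  shows "act x \<circ> act y = act (third x y)" "third x y \<noteq> Ga" "wt (third x y) \<le> wt x + wt y"
  using assms by (cases x; cases y; auto simp: third_def fun_eq_iff)+

lemma conj_to_trans:
  assumes "conj_to u v" "conj_to v w" shows "conj_to u w"
proof -
  obtain s t where s: "s \<in> grig" "s \<circ> ev v = ev u \<circ> s" and t: "t \<in> grig" "t \<circ> ev w = ev v \<circ> t"
    using assms unfolding conj_to_def by blast
  have "(s \<circ> t) \<circ> ev w = ev u \<circ> (s \<circ> t)"
    using s(2) t(2) by (metis comp_assoc)
  then show ?thesis unfolding conj_to_def using comp_in_grig[OF s(1) t(1)] by blast
qed

lemma conj_to_eq: "ev u = ev v \<Longrightarrow> conj_to u v"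
  unfolding conj_to_def by (rule bexI[of _ id]) simp_all

lemma conj_to_rotate: "conj_to (m @ [y]) (y # m)"
  unfolding conj_to_def by (rule bexI[of _ "act y"]) (auto simp: ev_append act_act)

lemma reduce_word: "\<exists>r. red r \<and> ev r = ev w \<and> wtw r \<le> wtw w \<and> length r \<le> length w"
proof (induction w)
  case Nil
  show ?case by (rule exI[of _ "[]"]) simp
next
  case (Cons l w)
  then obtain r where r: "red r" "ev r = ev w" "wtw r \<le> wtw w" "length r \<le> length w" by blast
  show ?case
  proof (cases r)
    case Nil
    then show ?thesis using r by (intro exI[of _ "[l]"]) auto
  next
    case (Cons y s)
    have ev: "ev (l # w) = (act l \<circ> act y) \<circ> ev s"
      using r(2) Cons by (metis comp_assoc ev.simps(2))
    consider "(l = Ga) \<noteq> (y = Ga)" | "l = y" | "l \<noteq> y" "l \<noteq> Ga" "y \<noteq> Ga" by blast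
    then show ?thesis
    proof cases
      case 1
      then show ?thesis using r Cons by (intro exI[of _ "l # r"]) simp
    next
      case 2
      have "red s" using r(1) Cons by (cases s) auto
      then show ?thesis using r Cons 2 ev by (intro exI[of _ s]) (simp add: act_comp_act)
    next
      case 3
      have "red (third l y # s)" using r(1) Cons 3 third(2) by (cases s) auto
      moreover have "ev (third l y # s) = ev (l # w)"
        unfolding ev using third(1)[OF 3] by simp
      ultimately show ?thesis using r Cons third(3)[OF 3] by (intro exI[of _ "third l y # s"]) simp
    qed
  qed
qed

lemma red_butlast: "red (m @ [y]) \<Longrightarrow> red m"
  by (induction m rule: red.induct) auto

lemma red_last: "red (m @ [y]) \<Longrightarrow> m \<noteq> [] \<Longrightarrow> (last m = Ga) \<noteq> (y = Ga)"
  by (induction m rule: red.induct) auto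

lemma red_alt:
  assumes "red w" "w \<noteq> []" "hd w = Ga" "last w \<noteq> Ga"
  shows "\<exists>xs. xs \<noteq> [] \<and> Ga \<notin> set xs \<and> w = alt xs"
  using assms
proof (induction "length w" arbitrary: w rule: less_induct)
  case less
  then obtain y s where w: "w = Ga # y # s"
    by (metis last_ConsL list.collapse)
  show ?case
  proof (cases s)
    case Nil
    then show ?thesis using less.prems w by (intro exI[of _ "[y]"]) auto
  next
    case (Cons z t)
    then have "red s" "s \<noteq> []" "hd s = Ga" "last s \<noteq> Ga" using less.prems w by auto
    then obtain xs where "Ga \<notin> set xs" "s = alt xs" using less.hyps[of s] w by auto
    then show ?thesis using less.prems w by (intro exI[of _ "y # xs"]) auto
  qed
qed

text \<open>In a reduced word the last letter is moved to the front. If it cancels or merges with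
  the first letter, the word has become shorter; otherwise the word or its rotation alternates from
  \<open>Ga\<close> on.\<close>

lemma conj_nform: "\<exists>r. nform r \<and> conj_to w r \<and> wtw r \<le> wtw w"
proof (induction "length w" arbitrary: w rule: less_induct)
  case less
  obtain r where r: "red r" "ev r = ev w" "wtw r \<le> wtw w" "length r \<le> length w"
    using reduce_word by blast
  have wr: "conj_to w r" using r(2) by (intro conj_to_eq) simp
  have step: ?case if rs: "conj_to r s" "wtw s \<le> wtw r" "length s < length r" for s
  proof -
    obtain t where "nform t" "conj_to s t" "wtw t \<le> wtw s"
      using less[of s] rs(3) r(4) by auto
    then show ?thesis using rs r(3) conj_to_trans[OF wr conj_to_trans[OF rs(1)]]
      by (meson le_trans)
  qed
  show ?case
  proof (cases "length r \<le> 1")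
    case True
    then show ?thesis using r wr unfolding nform_def by blast
  next
    case False
    obtain m y where my: "r = m @ [y]" using False by (cases r rule: rev_cases) auto
    then obtain x k where m: "m = x # k" using False by (cases m) auto
    have rot: "conj_to r (y # m)" unfolding my by (rule conj_to_rotate)
    consider "x = Ga" "y \<noteq> Ga" | "x \<noteq> Ga" "y = Ga" | "x = y" | "x \<noteq> y" "x \<noteq> Ga" "y \<noteq> Ga" by blast
    then show ?thesis
    proof cases
      case 1
      have "\<exists>xs. xs \<noteq> [] \<and> Ga \<notin> set xs \<and> r = alt xs"
        by (rule red_alt) (use r(1) my m 1 in auto)
      then have "nform r" unfolding nform_def by blast
      then show ?thesis using r wr by blast
    next
      case 2
      have "red m" "last m \<noteq> Ga"
        using red_butlast[of m y] red_last[of m y] 2 r(1) my m by simp_all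
      then have "\<exists>xs. xs \<noteq> [] \<and> Ga \<notin> set xs \<and> y # m = alt xs"
        by (intro red_alt) (use m 2 in auto)
      then have "nform (y # m)" unfolding nform_def by blast
      moreover have "wtw (y # m) \<le> wtw w" using r(3) my by simp
      ultimately show ?thesis using conj_to_trans[OF wr rot] by blast
    next
      case 3
      have "conj_to (y # m) k"
        by (rule conj_to_eq) (auto simp: m 3 act_act)
      then show ?thesis by (intro step[of k] conj_to_trans[OF rot]) (auto simp: my m)
    next
      case 4
      have t: "y \<noteq> x" "y \<noteq> Ga" "x \<noteq> Ga" using 4 by auto
      have "ev (y # m) = (act y \<circ> act x) \<circ> ev k" by (simp add: m comp_assoc)
      then have "conj_to (y # m) (third y x # k)"
        unfolding third(1)[OF t] by (intro conj_to_eq) simp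
      then show ?thesis using third(3)[OF t]
        by (intro step[of "third y x # k"] conj_to_trans[OF rot]) (auto simp: my m)
    qed
  qed
qed

section \<open>Decrease of the weight under passage to sections\<close>

lemma par_alt: "Ga \<notin> set xs \<Longrightarrow> par (alt xs) = odd (length xs)"
  by (induction xs) auto

text \<open>Each block of \<open>Ga\<close> and a letter loses exactly one unit of weight when it is
  distributed over the two sections.\<close>

lemma wtw_secw_alt:
  "Ga \<notin> set xs \<Longrightarrow> wtw (secw x (alt xs)) + wtw (secw (\<not> x) (alt xs)) + length xs = wtw (alt xs)"
proof (induction xs)
  case (Cons y xs)
  have "wtw (gsec y z) + wtw (gsec y (\<not> z)) + 1 = wt Ga + wt y" for z
    using Cons.prems by (cases y; cases z) auto
  from this[of "x \<noteq> par (alt xs)"] Cons show ?case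
    by simp
qed simp

text \<open>Consecutive letters meet opposite vertices, so a single section loses at least 4 for
  each pair of blocks; equality occurs for one d at 1 and one c at 0.\<close>

lemma wtw_secw_alt_even:
  assumes "Ga \<notin> set xs" "even (length xs)"
  shows "wtw (secw x (alt xs)) + 2 * length xs \<le> wtw (alt xs)"
  using assms
proof (induction xs rule: induct_list012)
  case (3 y z xs)
  have "wtw (gsec y (\<not> x)) + wtw (gsec z x) + 4 \<le> 2 * wt Ga + wt y + wt z"
    using 3(3) by (cases y; cases z; cases x) auto
  moreover have "\<not> par (alt xs)" "z \<noteq> Ga" "y \<noteq> Ga" using 3 par_alt by auto
  ultimately show ?case using 3 by simp
qed auto

text \<open>Induction on the total weight after passing to normal forms. Sections weigh less in
  total unless both words are among the empty word, b, c, d.\<close>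

lemma lifts_0_words: "lifts 0 (ev u) (ev v)"
proof (induction "wtw u + wtw v" arbitrary: u v rule: less_induct)
  case less
  obtain u' where u': "nform u'" "conj_to u u'" "wtw u' \<le> wtw u" using conj_nform by blast
  obtain v' where v': "nform v'" "conj_to v v'" "wtw v' \<le> wtw v" using conj_nform by blast
  have IH: "lifts 0 (ev p) (ev q)" if "wtw p + wtw q < wtw u' + wtw v'" for p q
    using less that u' v' by simp
  have short: "r \<in> {[], [Ga], [Gb], [Gc], [Gd]}" if "length r \<le> 1" for r
    using that by (cases r; cases "hd r") auto
  consider "par u' \<noteq> par v'" | "par u'" "par v'" | "\<not> par u'" "\<not> par v'" by blast
  then have "lifts 0 (ev u') (ev v')"
  proof cases
    case 1
    then show ?thesis by (intro lifts_swaps_neq) simp_all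
  next
    case 2
    have "wtw (secw x r) + wtw (secw (\<not> x) r) < wtw r" if "nform r" "par r" for x r
      using that(1) unfolding nform_def
    proof
      assume "length r \<le> 1"
      then show ?thesis using short[of r] that(2) by auto
    next
      assume "\<exists>xs. xs \<noteq> [] \<and> Ga \<notin> set xs \<and> r = alt xs"
      then obtain xs where xs: "xs \<noteq> []" "Ga \<notin> set xs" "r = alt xs" by blast
      then show ?thesis using wtw_secw_alt[of xs x] by (cases xs) auto
    qed
    note shrink = this
    have "lifts 0 (ev (secw (\<not> y) u' @ secw y u')) (ev (secw True v' @ secw False v'))" for y
      using shrink[OF u'(1) 2(1), of y] shrink[OF v'(1) 2(2), of True] by (intro IH) simp
    then have "lifts (Suc 0) (ev u') (ev v')"
      using 2 by (intro lifts_Suc_swapping) (simp_all add: ev_append)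
    then show ?thesis by (rule lifts_Suc_imp_0)
  next
    case 3
    have short_even: "r \<in> {[], [Gb], [Gc], [Gd]}" if "length r \<le> 1" "\<not> par r" for r
      using short[OF that(1)] that(2) by auto
    \<comment> \<open>The extreme case is d with section b, from weight 2 to 4. The loss of 4 in a
      long word outweighs this gain.\<close>
    have short_wt: "wtw (secw x r) \<le> wtw r + 2" if "length r \<le> 1" "\<not> par r" for x r
      using short_even[OF that] by (cases x) auto
    have long_wt: "wtw (secw x r) + 4 \<le> wtw r" if r: "nform r" "\<not> length r \<le> 1" "\<not> par r" for x r
    proof -
      obtain xs where xs: "xs \<noteq> []" "Ga \<notin> set xs" "r = alt xs" using r(1,2) unfolding nform_def by blast
      have e: "even (length xs)" using par_alt[OF xs(2)] r(3) xs(3) by simp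
      have "length xs \<noteq> 0" using xs(1) by simp
      with e have "length xs \<ge> 2" by presburger
      then show ?thesis using wtw_secw_alt_even[OF xs(2) e, of x] xs(3) by simp
    qed
    show ?thesis
    proof (cases "length u' \<le> 1 \<and> length v' \<le> 1")
      case True
      then have "ev u' \<in> {id, grig_b, grig_c, grig_d}" "ev v' \<in> {id, grig_b, grig_c, grig_d}"
        using short_even[of u'] short_even[of v'] 3 by auto
      then show ?thesis by (rule lifts_letters)
    next
      case False
      have "lifts 0 (ev (secw y u')) (ev (secw x v'))" for x y
      proof (rule IH)
        show "wtw (secw y u') + wtw (secw x v') < wtw u' + wtw v'"
          using short_wt[of u' y] short_wt[of v' x] long_wt[of u' y] long_wt[of v' x] False 3 u'(1) v'(1)
          by (cases "length u' \<le> 1"; cases "length v' \<le> 1") simp_all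
      qed
      then have "lifts (Suc 0) (ev u') (ev v')"
        using 3 by (intro lifts_Suc_fixing) simp_all
      then show ?thesis by (rule lifts_Suc_imp_0)
    qed
  qed
  then obtain s t where "s \<in> grig" "s \<circ> ev u' = ev u \<circ> s" "t \<in> grig" "t \<circ> ev v' = ev v \<circ> t"
    using u'(2) v'(2) unfolding conj_to_def by blast
  then show ?case using \<open>lifts 0 (ev u') (ev v')\<close>
    by (meson ev_in_grig lifts_conj_left lifts_conj_right)
qed

text \<open>With \<open>n = 0\<close> settled for all pairs, the section steps raise
  \<open>n\<close> without any appeal to weights.\<close>

theorem lifts_grig:
  assumes "g \<in> grig" "h \<in> grig"
  shows "lifts n g h"
  using assms
proof (induction n arbitrary: g h)
  case 0
  then show ?case by (auto simp: grig_def lifts_0_words)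
next
  case (Suc n)
  consider "swaps g \<noteq> swaps h" | "swaps g" "swaps h" | "\<not> swaps g" "\<not> swaps h" by blast
  then show ?case
  proof cases
    case 1
    then show ?thesis using Suc by (intro lifts_swaps_neq)
  next
    case 2
    then show ?thesis using Suc by (intro lifts_Suc_swapping) (simp_all del: comp_apply)
  next
    case 3
    then show ?thesis using Suc by (intro lifts_Suc_fixing) simp_all
  qed
qed

section \<open>Subgroups of finite index\<close>

fun plant :: "bool list \<Rightarrow> (bool list \<Rightarrow> bool list) \<Rightarrow> bool list \<Rightarrow> bool list" where
  "plant [] f = f" | "plant (x # v) f = only x (plant v f)"

fun secv :: "(bool list \<Rightarrow> bool list) \<Rightarrow> bool list \<Rightarrow> bool list \<Rightarrow> bool list" where
  "secv f [] = f" | "secv f (x # v) = secv (sec f x) v"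

lemma plant_KK: "k \<in> KK \<Longrightarrow> plant v k \<in> KK"
  by (induction v) (auto intro: only_KK)

lemma plant_comp: "plant v (f \<circ> g) = plant v f \<circ> plant v g"
  by (induction v) (simp_all only: plant.simps only_comp)

lemma plant_id: "plant v id = id"
  by (induction v) (simp_all only: plant.simps only_id)

lemma plant_append: "plant (u @ v) f = plant u (plant v f)"
  by (induction u) simp_all

lemma secv_in_grig [simp]: "f \<in> grig \<Longrightarrow> secv f v \<in> grig"
  by (induction v arbitrary: f) simp_all

lemma secv_append: "secv f (u @ v) = secv (secv f u) v"
  by (induction u arbitrary: f) simp_all

lemma grig_append: "s \<in> grig \<Longrightarrow> s (u @ w) = s u @ secv s u w"
  by (induction u arbitrary: s) (simp_all add: grig_Nil grig_Cons)

lemma secv_id: "secv id v = id"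
  by (induction v) (simp_all only: secv.simps sec_id)

lemma conj_plant:
  assumes "s \<in> grig"
  shows "s \<circ> plant v k = plant (s v) (secv s v \<circ> k \<circ> ginv (secv s v)) \<circ> s"
  using assms
proof (induction v arbitrary: s)
  case Nil
  then show ?case by (auto simp: grig_Nil grig_inv_app)
next
  case (Cons x v)
  let ?r = "sec s x"
  have r: "?r \<in> grig" using Cons.prems by simp
  have "?r \<circ> plant v k \<circ> ginv ?r = plant (?r v) (secv ?r v \<circ> k \<circ> ginv (secv ?r v)) \<circ> (?r \<circ> ginv ?r)"
    unfolding Cons.IH[OF r] by (simp only: comp_assoc)
  then have "?r \<circ> plant v k \<circ> ginv ?r = plant (?r v) (secv ?r v \<circ> k \<circ> ginv (secv ?r v))"
    using grig_inv(2)[OF r] by simp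
  then show ?case
    using Cons.prems conj_only[of s x "plant v k"] by (simp only: plant.simps secv.simps grig_Cons)
qed

text \<open>Built from the bottom up by \<open>sec_surj\<close>; composing with a, whose sections
  are trivial, adjusts the first letter without changing sections.\<close>

lemma grig_transitive:
  assumes "length v = length w" "f \<in> grig"
  shows "\<exists>s\<in>grig. s v = w \<and> secv s v = f"
  using assms
proof (induction v arbitrary: w)
  case Nil
  then show ?case by (intro bexI[of _ f]) (auto simp: grig_Nil)
next
  case (Cons x v)
  then obtain y u where w: "w = y # u" "length v = length u" by (cases w) auto
  obtain r where r: "r \<in> grig" "r v = u" "secv r v = f" using Cons.IH[OF w(2)] Cons.prems by blast
  obtain s where s: "s \<in> grig" "\<not> swaps s" "sec s x = r" using sec_surj[OF r(1)] by blast
  show ?case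
  proof (cases "x = y")
    case True
    then show ?thesis using s r w by (intro bexI[of _ s]) (auto simp: grig_Cons)
  next
    case False
    have "grig_a \<circ> s \<in> grig" using s by simp
    moreover have "sec (grig_a \<circ> s) x = r" "swaps (grig_a \<circ> s)"
      using s by (simp_all add: sec_comp swaps_comp del: comp_apply)
    ultimately show ?thesis using r w False
      by (intro bexI[of _ "grig_a \<circ> s"]) (auto simp: grig_Cons simp del: comp_apply)
  qed
qed

text \<open>The sections of \<open>f\<close> at level \<open>L\<close> fix three levels, hence lie
  in K, and \<open>f\<close> is the product of their copies.\<close>

lemma agree_id_in:
  assumes "f \<in> grig" "agree (L + 3) f id"
    and "\<And>v k. length v = L \<Longrightarrow> k \<in> KK \<Longrightarrow> plant v k \<in> S"
    and "\<And>x y. x \<in> S \<Longrightarrow> y \<in> S \<Longrightarrow> x \<circ> y \<in> S"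
  shows "f \<in> S"
  using assms
proof (induction L arbitrary: f S)
  case 0
  have "agree 3 f id" using 0(2) by (simp only: add_0)
  then have "f \<in> KK" using 0(1) by (intro sigma_trivial_KK agree_sigma) simp_all
  then show ?case using 0(3)[of "[]" f] by simp
next
  case (Suc L)
  have "agree (Suc (L + 3)) f id" using Suc.prems(2) by (simp only: add_Suc)
  then have f: "\<not> swaps f" "\<And>x. agree (L + 3) (sec f x) id"
    using Suc.prems(1) by (simp_all only: agree_Suc id_in_grig sec_id swaps_id simp_thms)
  \<comment> \<open>The preimage of \<open>S\<close> under copying to \<open>x\<close> satisfies the
    hypotheses one level higher, so \<open>S\<close> has to vary in the induction.\<close>
  have "sec f x \<in> {g. only x g \<in> S}" for x
  proof (rule Suc.IH[OF _ f(2)])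
    show "plant v k \<in> {g. only x g \<in> S}" if "length v = L" "k \<in> KK" for v k
      using Suc.prems(3)[of "x # v" k] that by simp
    show "g \<circ> h \<in> {g. only x g \<in> S}" if "g \<in> {g. only x g \<in> S}" "h \<in> {g. only x g \<in> S}" for g h
      using that Suc.prems(4) by (simp only: mem_Collect_eq only_comp)
  qed (use Suc.prems in simp)
  then have "only False (sec f False) \<circ> only True (sec f True) \<in> S"
    using Suc.prems(4) by blast
  moreover have "only False (sec f False) \<circ> only True (sec f True) = f"
  proof
    fix w show "(only False (sec f False) \<circ> only True (sec f True)) w = f w"
      using Suc.prems(1) f(1) by (cases w rule: grig_a.cases) (auto simp: grig_Nil grig_Cons)
  qed
  ultimately show ?case by simp
qed

lemma ginv_grt_commutator: "grt = only True grt \<circ> (grig_d \<circ> grt \<circ> ginv grig_d)"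
proof -
  have "only True grt \<circ> (grig_d \<circ> grt) \<circ> ginv grig_d = grt \<circ> (grig_d \<circ> ginv grig_d)"
    unfolding grt_commutator by (simp only: comp_assoc)
  then show ?thesis using grig_inv(2)[of grig_d] by (simp add: comp_assoc)
qed

text \<open>
  The vertices \<open>1^i 0 1 1\<close> and \<open>1^j 0 1 1\<close> with \<open>i < j\<close> carry copies of \<open>grt\<close> in the same coset. An
  element with section \<open>a d a = (b, 1)\<close> at \<open>1^i\<close> acts as \<open>d\<close> below the first and trivially below the
  second one, so a commutator isolates \<open>grt \<cdot> (d grt d)\<^sup>-\<^sup>1 = (1, grt)\<close> at the first one.
\<close>

lemma pigeonhole_vertex:
  assumes N: "N \<subseteq> grig" "\<And>x y. x \<in> N \<Longrightarrow> y \<in> N \<Longrightarrow> x \<circ> y \<in> N" "\<And>x. x \<in> N \<Longrightarrow> ginv x \<in> N"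
    "\<And>g x. g \<in> grig \<Longrightarrow> x \<in> N \<Longrightarrow> g \<circ> x \<circ> ginv g \<in> N"
    and ij: "i < j"
    and n: "plant (replicate i True @ [False, True, True]) grt \<circ>
      ginv (plant (replicate j True @ [False, True, True]) grt) \<in> N"
  shows "plant (replicate i True @ [False, True, True, True]) grt \<in> N"
proof -
  let ?u = "replicate i True"
  define vi where "vi = ?u @ [False, True, True]"
  obtain p where p: "replicate j True @ [False, True, True] = ?u @ True # p"
  proof -
    have "replicate j True = ?u @ replicate (j - i) True"
      using ij by (simp flip: replicate_add)
    moreover have "replicate (j - i) True = True # replicate (j - i - 1) True"
      using ij by (cases "j - i") auto
    ultimately show ?thesis by (intro that[of "replicate (j - i - 1) True @ [False, True, True]"]) simp
  qed
  define vj where "vj = ?u @ True # p"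
  define y where "y = grig_a \<circ> grig_d \<circ> grig_a"
  have y: "y \<in> grig" by (simp add: y_def del: comp_apply)
  have ysec: "sec y False = grig_b" "sec y True = id" "\<not> swaps y"
    by (simp_all add: y_def sec_comp swaps_comp del: comp_apply id_apply)
  obtain s where s: "s \<in> grig" "s ?u = ?u" "secv s ?u = y"
    using grig_transitive[OF refl y] by blast
  \<comment> \<open>Along 0, 1, 1 the sections of \<open>y\<close> are b, c, d, hence the ending of
    the vertices. The path to \<open>vj\<close> leaves \<open>?u\<close> through 1, where
    \<open>y\<close> has trivial section.\<close>
  have si: "s vi = vi" "secv s vi = grig_d"
    unfolding vi_def using s y ysec
    by (simp_all add: grig_append secv_append grig_Cons)
  have sj: "s vj = vj" "secv s vj = id"
    unfolding vj_def using s y ysec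
    by (simp_all add: grig_append secv_append grig_Cons secv_id del: id_apply) simp
  define x where "x = plant vi grt"
  define x' where "x' = plant vi (grig_d \<circ> grt \<circ> ginv grig_d)"
  define z where "z = plant vj grt"
  have xz: "x \<in> grig" "z \<in> grig"
    unfolding x_def z_def using plant_KK[OF grt_in_KK] KK_in_grig by blast+
  have x'g: "x' \<in> grig"
    unfolding x'_def by (rule KK_in_grig[OF plant_KK[OF KK_conj[OF gens_in_grig(4) grt_in_KK]]])
  have sx: "s \<circ> x = x' \<circ> s" using conj_plant[OF s(1), of vi grt] si by (simp add: x_def x'_def)
  have "s \<circ> z = plant vj (id \<circ> grt \<circ> ginv id) \<circ> s"
    using conj_plant[OF s(1), of vj grt] sj by (simp add: z_def)
  then have sz: "s \<circ> z = z \<circ> s" by (simp add: z_def inv_id)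
  have nN: "x \<circ> ginv z \<in> N" using n p by (simp add: x_def z_def vi_def vj_def)
  have "s \<circ> (x \<circ> ginv z) \<circ> ginv s = x' \<circ> ginv z"
  proof
    fix w
    have "s (x v) = x' (s v)" "s (z v) = z (s v)" for v
      using sx sz by (metis comp_apply)+
    then have "s (ginv z v) = ginv z (s v)" for v
      using xz(2) by (metis grig_inv_app)
    then show "(s \<circ> (x \<circ> ginv z) \<circ> ginv s) w = (x' \<circ> ginv z) w"
      using \<open>\<And>v. s (x v) = x' (s v)\<close> s(1) by (simp add: grig_inv_app)
  qed
  then have "x' \<circ> ginv z \<in> N" using N(4)[OF s(1) nN] by simp
  then have "(x \<circ> ginv z) \<circ> ginv (x' \<circ> ginv z) \<in> N" by (rule N(2)[OF nN N(3)])
  moreover have "(x \<circ> ginv z) \<circ> ginv (x' \<circ> ginv z) = x \<circ> ginv x'"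
  proof -
    have "ginv (x' \<circ> ginv z) = ginv (ginv z) \<circ> ginv x'"
      using xz x'g by (intro ginv_comp) simp_all
    moreover have "ginv z \<circ> ginv (ginv z) = id" using xz grig_inv(2)[of "ginv z"] by simp
    ultimately show ?thesis by (metis comp_assoc comp_id)
  qed
  moreover have "x = plant vi (only True grt) \<circ> x'"
    unfolding x_def x'_def plant_comp[symmetric] by (rule arg_cong[OF ginv_grt_commutator])
  then have "x \<circ> ginv x' = plant vi (only True grt)"
    using grig_inv(2)[OF x'g] by (simp add: comp_assoc)
  moreover have "plant vi (only True grt) = plant (vi @ [True]) grt" by (simp add: plant_append)
  ultimately show ?thesis by (simp add: vi_def)
qed

text \<open>\<open>c\<close> stands for the coset map. Two of infinitely many copies of
  \<open>grt\<close> share a coset, so \<open>N\<close> contains some copy of \<open>grt\<close>;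
  conjugation spreads it to all copies of K on that level.\<close>

lemma finite_index_congruence:
  assumes N: "N \<subseteq> grig" "\<And>x y. x \<in> N \<Longrightarrow> y \<in> N \<Longrightarrow> x \<circ> y \<in> N" "\<And>x. x \<in> N \<Longrightarrow> ginv x \<in> N"
    "\<And>g x. g \<in> grig \<Longrightarrow> x \<in> N \<Longrightarrow> g \<circ> x \<circ> ginv g \<in> N"
    and fin: "finite (c ` grig)" "\<And>x y. x \<in> grig \<Longrightarrow> y \<in> grig \<Longrightarrow> c x = c y \<Longrightarrow> x \<circ> ginv y \<in> N"
  shows "\<exists>L. \<forall>f\<in>grig. agree L f id \<longrightarrow> f \<in> N"
proof -
  define t where "t i = plant (replicate i True @ [False, True, True]) grt" for i
  have tg: "t i \<in> grig" for i
    unfolding t_def using plant_KK[OF grt_in_KK] KK_in_grig by blast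
  have "\<not> inj (\<lambda>i. c (t i))"
  proof
    assume "inj (\<lambda>i. c (t i))"
    then have "infinite (range (\<lambda>i. c (t i)))" using range_inj_infinite by blast
    moreover have "range (\<lambda>i. c (t i)) \<subseteq> c ` grig" using tg by auto
    ultimately show False using fin(1) finite_subset by blast
  qed
  then obtain i j where "c (t i) = c (t j)" "i \<noteq> j" unfolding inj_def by blast
  then obtain i j where ij: "c (t i) = c (t j)" "i < j" by (metis linorder_neqE_nat)
  define w where "w = replicate i True @ [False, True, True, True]"
  have w: "plant w grt \<in> N"
    unfolding w_def
    by (rule pigeonhole_vertex[OF N ij(2)]) (use fin(2)[OF tg tg ij(1)] in \<open>simp_all add: t_def\<close>)
  have wN: "plant v k \<in> N" if vw: "length v = length w" and "k \<in> KK" for v k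
    using that(2)
  proof (induction rule: KK.induct)
    case id
    have "ginv (plant w grt) \<circ> plant w grt \<in> N" by (rule N(2)[OF N(3)[OF w] w])
    then have "id \<in> N" using grig_inv(1)[of "plant w grt"] w N(1) by (simp add: subset_iff)
    then show ?case unfolding plant_id .
  next
    case (conj f k)
    obtain s where s: "s \<in> grig" "s w = v" "secv s w = f"
      using grig_transitive[OF vw[symmetric] conj(1)] by blast
    have "s \<circ> plant w grt \<circ> ginv s = plant v (f \<circ> grt \<circ> ginv f) \<circ> (s \<circ> ginv s)"
      using conj_plant[OF s(1), of w grt] s by (simp add: comp_assoc)
    then have "plant v (f \<circ> grt \<circ> ginv f) \<in> N"
      using N(4)[OF s(1) w] grig_inv(2)[OF s(1)] by simp
    then show ?case unfolding plant_comp[of v "f \<circ> grt \<circ> ginv f"] using conj.IH by (rule N(2))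
  qed
  have "f \<in> N" if "f \<in> grig" "agree (length w + 3) f id" for f
    using that wN N(2) by (rule agree_id_in)
  then show ?thesis by blast
qed

section \<open>The Grigorchuk group and its profinite completion\<close>

lemma one_tree_Aut: "\<one>\<^bsub>tree_Aut\<^esub> = id"
  by (auto simp: tree_Aut_def BijGroup_def restrict_def)

lemma carrier_Grigorchuk_eq: "carrier Grigorchuk = grig"
proof -
  interpret T: group tree_Aut by (rule group_tree_Aut)
  let ?S = "{grig_a, grig_b, grig_c, grig_d}"
  note S = grig_generators_in_tree_Aut
  have gen: "act l \<in> ?S" for l by (cases l) auto
  have "h \<in> grig" if "h \<in> generate tree_Aut ?S" for h
    using that
  proof (induction rule: generate.induct)
    case one
    show ?case unfolding one_tree_Aut by (rule id_in_grig)
  next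
    case (incl h)
    then show ?case by auto
  next
    case (inv h)
    have "h \<circ> h = id" using inv by auto
    then have "h \<otimes>\<^bsub>tree_Aut\<^esub> h = \<one>\<^bsub>tree_Aut\<^esub>"
      using inv S by (simp only: mult_tree_Aut[OF subsetD[OF S inv] subsetD[OF S inv]] one_tree_Aut)
    then have "inv\<^bsub>tree_Aut\<^esub> h = h"
      using inv S by (intro T.inv_equality) auto
    then show ?case using inv by auto
  next
    case (eng h1 h2)
    then show ?case
      using T.generate_in_carrier[OF S] by (simp add: mult_tree_Aut del: comp_apply)
  qed
  moreover have "ev w \<in> generate tree_Aut ?S" for w
  proof (induction w)
    case Nil
    show ?case using generate.one[of tree_Aut ?S] by (simp only: one_tree_Aut ev.simps)
  next
    case (Cons l w)
    have "act l \<in> generate tree_Aut ?S" using gen by (rule generate.incl)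
    from generate.eng[OF this Cons] show ?case
      using T.generate_in_carrier[OF S \<open>act l \<in> generate tree_Aut ?S\<close>] T.generate_in_carrier[OF S Cons]
      by (simp only: mult_tree_Aut ev.simps)
  qed
  ultimately show ?thesis unfolding carrier_Grigorchuk by (auto simp: grig_def)
qed

lemma mult_Grigorchuk: "f \<in> grig \<Longrightarrow> g \<in> grig \<Longrightarrow> f \<otimes>\<^bsub>Grigorchuk\<^esub> g = f \<circ> g"
proof -
  assume "f \<in> grig" "g \<in> grig"
  moreover have "grig \<subseteq> carrier tree_Aut"
    unfolding carrier_Grigorchuk_eq[symmetric] Grigorchuk_def carrier_subgroup_generated
    using group.generate_incl[OF group_tree_Aut, of "carrier tree_Aut \<inter> {grig_a, grig_b, grig_c, grig_d}"] by blast
  ultimately show ?thesis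
    unfolding Grigorchuk_def using mult_tree_Aut by (simp add: subset_iff subgroup_generated_def)
qed

lemma one_Grigorchuk: "\<one>\<^bsub>Grigorchuk\<^esub> = id"
  using one_tree_Aut by (simp add: Grigorchuk_def subgroup_generated_def)

lemma inv_Grigorchuk: "f \<in> grig \<Longrightarrow> inv\<^bsub>Grigorchuk\<^esub> f = ginv f"
  by (rule group.inv_equality[OF group_Grigorchuk])
    (simp_all add: mult_Grigorchuk one_Grigorchuk carrier_Grigorchuk_eq grig_inv(1))

section \<open>Level stabilisers and the congruence subgroup property\<close>

definition level_stab :: "nat \<Rightarrow> (bool list \<Rightarrow> bool list) set" where
  "level_stab m = {f \<in> grig. agree m f id}"

lemma r_coset_eq_iff:
  assumes "N \<lhd> Grigorchuk" "f \<in> grig" "g \<in> grig"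
  shows "N #>\<^bsub>Grigorchuk\<^esub> f = N #>\<^bsub>Grigorchuk\<^esub> g \<longleftrightarrow> f \<circ> ginv g \<in> N"
proof -
  interpret N: normal N Grigorchuk by fact
  have c: "f \<in> carrier Grigorchuk" "g \<in> carrier Grigorchuk"
    using assms by (simp_all add: carrier_Grigorchuk_eq)
  have e: "f \<otimes>\<^bsub>Grigorchuk\<^esub> inv\<^bsub>Grigorchuk\<^esub> g = f \<circ> ginv g"
    using assms by (simp add: mult_Grigorchuk inv_Grigorchuk)
  show ?thesis
  proof
    assume "N #>\<^bsub>Grigorchuk\<^esub> f = N #>\<^bsub>Grigorchuk\<^esub> g"
    then have "f \<in> N #>\<^bsub>Grigorchuk\<^esub> g"
      using N.rcos_self[OF c(1) N.subgroup_axioms] by simp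
    then show "f \<circ> ginv g \<in> N"
      using N.rcos_module[OF N.is_group c(2) c(1)] e by simp
  next
    assume "f \<circ> ginv g \<in> N"
    then have "f \<in> N #>\<^bsub>Grigorchuk\<^esub> g"
      using N.rcos_module[OF N.is_group c(2) c(1)] e by simp
    then show "N #>\<^bsub>Grigorchuk\<^esub> f = N #>\<^bsub>Grigorchuk\<^esub> g"
      using N.repr_independence[OF _ c(2) N.subgroup_axioms] by simp
  qed
qed

lemma normal_level_stab: "level_stab m \<lhd> Grigorchuk"
proof -
  interpret G: group Grigorchuk by (rule group_Grigorchuk)
  have inv_mem: "ginv f \<in> level_stab m" if f: "f \<in> level_stab m" for f
  proof -
    have g: "f \<in> grig" and a: "agree m f id" using f by (simp_all add: level_stab_def)
    have "agree m (ginv f \<circ> f) (ginv f \<circ> id)" by (rule agree_comp_left[OF a])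
    then have "agree m (ginv f) id" using grig_inv(1)[OF g] agree_sym by simp
    then show ?thesis using g by (simp add: level_stab_def)
  qed
  have comp_mem: "f \<circ> g \<in> level_stab m" if f: "f \<in> level_stab m" "g \<in> level_stab m" for f g
  proof -
    have "agree m (f \<circ> g) (id \<circ> g)" using f by (intro agree_comp_right) (simp_all add: level_stab_def)
    then have "agree m (f \<circ> g) id" using f agree_trans[of m "f \<circ> g" g id] by (simp add: level_stab_def)
    then show ?thesis using f by (simp add: level_stab_def del: comp_apply)
  qed
  have "subgroup (level_stab m) Grigorchuk"
  proof (rule G.subgroupI)
    show "level_stab m \<subseteq> carrier Grigorchuk" by (auto simp: level_stab_def carrier_Grigorchuk_eq)
    have "id \<in> level_stab m" by (simp add: level_stab_def agree_def)
    then show "level_stab m \<noteq> {}" by blast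
  next
    fix f assume "f \<in> level_stab m"
    then show "inv\<^bsub>Grigorchuk\<^esub> f \<in> level_stab m"
      using inv_mem inv_Grigorchuk by (simp add: level_stab_def)
  next
    fix f g assume fg: "f \<in> level_stab m" "g \<in> level_stab m"
    then have "f \<otimes>\<^bsub>Grigorchuk\<^esub> g = f \<circ> g" by (intro mult_Grigorchuk) (simp_all add: level_stab_def)
    then show "f \<otimes>\<^bsub>Grigorchuk\<^esub> g \<in> level_stab m" using comp_mem[OF fg] by simp
  qed
  moreover have "x \<otimes>\<^bsub>Grigorchuk\<^esub> h \<otimes>\<^bsub>Grigorchuk\<^esub> inv\<^bsub>Grigorchuk\<^esub> x \<in> level_stab m"
    if "x \<in> carrier Grigorchuk" "h \<in> level_stab m" for x h
  proof -
    have x: "x \<in> grig" and h: "h \<in> grig" "agree m h id"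
      using that by (simp_all add: carrier_Grigorchuk_eq level_stab_def)
    have "agree m (x \<circ> (h \<circ> ginv x)) (x \<circ> (id \<circ> ginv x))"
      by (intro agree_comp_left agree_comp_right h) (use x in simp)
    then have "agree m (x \<circ> h \<circ> ginv x) id" using grig_inv(2)[OF x] by (simp add: comp_assoc)
    then have "x \<circ> h \<circ> ginv x \<in> level_stab m" using x h by (simp add: level_stab_def del: comp_apply)
    then show ?thesis using x h by (simp add: mult_Grigorchuk inv_Grigorchuk del: comp_apply)
  qed
  ultimately show ?thesis unfolding G.normal_inv_iff by blast
qed

lemma level_stab_coset_iff:
  assumes "f \<in> grig" "g \<in> grig"
  shows "level_stab m #>\<^bsub>Grigorchuk\<^esub> f = level_stab m #>\<^bsub>Grigorchuk\<^esub> g \<longleftrightarrow> agree m f g"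
proof -
  have "agree m (f \<circ> ginv g) id \<longleftrightarrow> agree m f g"
  proof
    assume "agree m (f \<circ> ginv g) id"
    then have "agree m (f \<circ> ginv g \<circ> g) (id \<circ> g)" using assms(2) by (rule agree_comp_right)
    then show "agree m f g" using grig_inv(1)[OF assms(2)] by (simp add: comp_assoc)
  next
    assume "agree m f g"
    then have "agree m (f \<circ> ginv g) (g \<circ> ginv g)" using assms(2) by (intro agree_comp_right) simp_all
    then show "agree m (f \<circ> ginv g) id" using grig_inv(2)[OF assms(2)] by simp
  qed
  then show ?thesis
    unfolding r_coset_eq_iff[OF normal_level_stab assms] using assms
    by (simp add: level_stab_def del: comp_apply)
qed

text \<open>A coset is determined by the restriction to the finitely many words of length at most
  \<open>m\<close>.\<close>

lemma level_stab_fin_index: "level_stab m \<in> fin_index_normal Grigorchuk"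
proof -
  let ?A = "{w :: bool list. length w \<le> m}"
  let ?c = "\<lambda>f. level_stab m #>\<^bsub>Grigorchuk\<^esub> f"
  have A: "finite ?A"
    using finite_lists_length_le[of "UNIV :: bool set" m] by simp
  have fin: "finite ((\<lambda>f. restrict f ?A) ` grig)"
  proof (rule finite_subset)
    show "(\<lambda>f. restrict f ?A) ` grig \<subseteq> ?A \<rightarrow>\<^sub>E ?A"
      by (simp only: image_subset_iff restrict_PiE_iff) simp
    show "finite (?A \<rightarrow>\<^sub>E ?A)"
      by (rule finite_PiE[OF A A])
  qed
  have "?c f = ?c g" if "f \<in> grig" "g \<in> grig" "restrict f ?A = restrict g ?A" for f g
  proof -
    have "f w = g w" if "length w \<le> m" for w
      using fun_cong[OF \<open>restrict f ?A = restrict g ?A\<close>, of w] that by simp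
    then show ?thesis using level_stab_coset_iff[OF that(1,2)] by (simp add: agree_def)
  qed
  then have "?c ` grig \<subseteq> (\<lambda>r. ?c (SOME f. f \<in> grig \<and> restrict f ?A = r)) ` ((\<lambda>f. restrict f ?A) ` grig)"
  proof (intro subsetI, elim imageE)
    fix C f assume same: "\<And>f g. \<lbrakk>f \<in> grig; g \<in> grig; restrict f ?A = restrict g ?A\<rbrakk> \<Longrightarrow> ?c f = ?c g"
      and C: "C = ?c f" and f: "f \<in> grig"
    let ?g = "SOME g. g \<in> grig \<and> restrict g ?A = restrict f ?A"
    have "?g \<in> grig \<and> restrict ?g ?A = restrict f ?A"
      by (rule someI[of _ f]) (simp add: f)
    then have "C = ?c ?g" unfolding C by (intro same f) simp_all
    then show "C \<in> (\<lambda>r. ?c (SOME f. f \<in> grig \<and> restrict f ?A = r)) ` ((\<lambda>f. restrict f ?A) ` grig)"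
      using f by blast
  qed
  then have "finite (?c ` grig)" using fin finite_surj by blast
  moreover have "rcosets\<^bsub>Grigorchuk\<^esub> (level_stab m) = ?c ` grig"
    by (auto simp: RCOSETS_def carrier_Grigorchuk_eq)
  ultimately show ?thesis using normal_level_stab by (simp add: fin_index_normal_def)
qed

lemma fin_index_normal_congruence:
  assumes "N \<in> fin_index_normal Grigorchuk"
  shows "\<exists>n. level_stab n \<subseteq> N"
proof -
  have N: "N \<lhd> Grigorchuk" and fin: "finite (rcosets\<^bsub>Grigorchuk\<^esub> N)"
    using assms by (auto simp: fin_index_normal_def)
  interpret N: normal N Grigorchuk by fact
  have sub: "N \<subseteq> grig" using N.subset by (simp add: carrier_Grigorchuk_eq)
  have "\<exists>L. \<forall>f\<in>grig. agree L f id \<longrightarrow> f \<in> N"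
  proof (rule finite_index_congruence[OF sub])
    show "x \<circ> y \<in> N" if "x \<in> N" "y \<in> N" for x y
      using subgroup.m_closed[OF N.subgroup_axioms that]
        mult_Grigorchuk[OF subsetD[OF sub that(1)] subsetD[OF sub that(2)]] by (simp only:)
    show "ginv x \<in> N" if "x \<in> N" for x
      using subgroup.m_inv_closed[OF N.subgroup_axioms that]
        inv_Grigorchuk[OF subsetD[OF sub that]] by (simp only:)
    show "g \<circ> x \<circ> ginv g \<in> N" if "g \<in> grig" "x \<in> N" for g x
    proof -
      have "x \<in> grig" using that sub by auto
      then show ?thesis
        using N.inv_op_closed2[of g x, unfolded carrier_Grigorchuk_eq, OF that] that(1)
        by (simp only: mult_Grigorchuk inv_Grigorchuk comp_in_grig inv_in_grig)
    qed
    show "finite ((\<lambda>f. N #>\<^bsub>Grigorchuk\<^esub> f) ` grig)"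
      by (rule finite_subset[OF _ fin]) (auto simp: RCOSETS_def carrier_Grigorchuk_eq)
    show "x \<circ> ginv y \<in> N"
      if "x \<in> grig" "y \<in> grig" "N #>\<^bsub>Grigorchuk\<^esub> x = N #>\<^bsub>Grigorchuk\<^esub> y" for x y
      using r_coset_eq_iff[OF N] that by blast
  qed
  then show ?thesis by (auto simp: level_stab_def)
qed

section \<open>Approximation in the completion and density\<close>

lemma mult_profinite_completion:
  "N \<in> fin_index_normal G \<Longrightarrow> (x \<otimes>\<^bsub>profinite_completion G\<^esub> y) N = x N <#>\<^bsub>G\<^esub> y N"
  by (simp add: profinite_completion_def product_group_def FactGroup_def)

lemma (in group) profinite_embedding_centraliser:
  assumes "g \<in> carrier G"
  shows "profinite_embedding G ` centraliser G g
    \<subseteq> centraliser (profinite_completion G) (profinite_embedding G g)"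
  using assms
  by (auto simp: centraliser_def profinite_embedding_in_carrier simp flip: profinite_embedding_mult)

text \<open>The coordinate of \<open>x\<close> at a deep level stabiliser is the coset of some
  \<open>f\<close> commuting with \<open>g\<close> modulo that level. Its exact correction has the
  same coordinates at all \<open>N\<close> in \<open>F\<close>.\<close>

lemma centraliser_approximation:
  assumes g: "g \<in> grig"
    and x: "x \<in> centraliser (profinite_completion Grigorchuk) (profinite_embedding Grigorchuk g)"
    and F: "finite F" "F \<subseteq> fin_index_normal Grigorchuk"
  shows "\<exists>f \<in> centraliser Grigorchuk g. \<forall>N\<in>F. profinite_embedding Grigorchuk f N = x N"
proof -
  obtain d where d: "\<And>N. N \<in> F \<Longrightarrow> level_stab (d N) \<subseteq> N"
    using fin_index_normal_congruence F(2) by (metis subsetD)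
  define n where "n = (\<Sum>N\<in>F. d N)"
  have nF: "level_stab n \<subseteq> N" if "N \<in> F" for N
  proof -
    have "d N \<le> n" unfolding n_def using that F(1) by (intro member_le_sum) auto
    then have "level_stab n \<subseteq> level_stab (d N)" using agree_mono by (auto simp: level_stab_def)
    then show ?thesis using d[OF that] by blast
  qed
  obtain k where k: "lifts_at k n g g" using lifts_grig[OF g g] unfolding lifts_def by blast
  \<comment> \<open>At least \<open>k\<close> for the lifting, and at least \<open>n\<close> so that
    the coordinate at level \<open>m\<close> determines those in \<open>F\<close>.\<close>
  define m where "m = max k n"
  have m: "lifts_at m n g g" using k lifts_at_mono by (simp add: m_def)
  let ?M = "level_stab m"
  have M: "?M \<in> fin_index_normal Grigorchuk" "?M \<lhd> Grigorchuk"
    using level_stab_fin_index normal_level_stab by auto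
  interpret M: normal ?M Grigorchuk by (rule M(2))
  have xc: "x \<in> carrier (profinite_completion Grigorchuk)"
    and comm: "x \<otimes>\<^bsub>profinite_completion Grigorchuk\<^esub> profinite_embedding Grigorchuk g =
      profinite_embedding Grigorchuk g \<otimes>\<^bsub>profinite_completion Grigorchuk\<^esub> x"
    using x by (auto simp: centraliser_def)
  have "x ?M \<in> carrier (Grigorchuk Mod ?M)"
    using xc M(1) by (auto simp: profinite_completion_def)
  then obtain f where f: "f \<in> grig" "x ?M = ?M #>\<^bsub>Grigorchuk\<^esub> f"
    by (auto simp: carrier_FactGroup carrier_Grigorchuk_eq)
  have "x ?M <#>\<^bsub>Grigorchuk\<^esub> (?M #>\<^bsub>Grigorchuk\<^esub> g) = (?M #>\<^bsub>Grigorchuk\<^esub> g) <#>\<^bsub>Grigorchuk\<^esub> x ?M"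
    using fun_cong[OF comm, of ?M] M(1) by (simp add: mult_profinite_completion profinite_embedding_def)
  then have "?M #>\<^bsub>Grigorchuk\<^esub> (f \<circ> g) = ?M #>\<^bsub>Grigorchuk\<^esub> (g \<circ> f)"
    using f g by (simp add: M.rcos_sum carrier_Grigorchuk_eq mult_Grigorchuk)
  then have "agree m (g \<circ> f) (f \<circ> g)"
    using level_stab_coset_iff f(1) g agree_sym by (metis comp_in_grig)
  then obtain f' where f': "f' \<in> grig" "sim n f' f" "g \<circ> f' = f' \<circ> g"
    using m f(1) unfolding lifts_at_def by blast
  have "f' \<in> centraliser Grigorchuk g"
    using f' g by (simp add: centraliser_def carrier_Grigorchuk_eq mult_Grigorchuk)
  moreover have "profinite_embedding Grigorchuk f' N = x N" if NF: "N \<in> F" for N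
  proof -
    have N: "N \<in> fin_index_normal Grigorchuk" "N \<lhd> Grigorchuk"
      using NF F(2) by (auto simp: fin_index_normal_def)
    have "?M \<subseteq> level_stab n" using agree_mono by (auto simp: level_stab_def m_def)
    then have MN: "?M \<subseteq> N" using nF[OF NF] by blast
    have "x N = coset_proj Grigorchuk N (x ?M)"
      using xc M(1) N(1) MN by (simp add: profinite_completion_def)
    also have "\<dots> = N #>\<^bsub>Grigorchuk\<^esub> f"
      unfolding f(2) using coset_proj_r_coset[OF M(2) N(2) MN] f(1) by (simp add: carrier_Grigorchuk_eq)
    also have "\<dots> = N #>\<^bsub>Grigorchuk\<^esub> f'"
    proof -
      have "agree n f f'" using sim_agree f' f(1) agree_sym by blast
      then have "agree n (f \<circ> ginv f') (f' \<circ> ginv f')"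
        using f'(1) by (intro agree_comp_right) simp_all
      then have "f \<circ> ginv f' \<in> level_stab n"
        using f(1) f'(1) grig_inv(2)[OF f'(1)] by (simp add: level_stab_def del: comp_apply)
      then show ?thesis using r_coset_eq_iff[OF N(2) f(1) f'(1)] nF[OF NF] by blast
    qed
    finally show ?thesis using N(1) by (simp add: profinite_embedding_def)
  qed
  ultimately show ?thesis by blast
qed

theorem corollary5p16:
  assumes "g \<in> carrier Grigorchuk"
  shows "dense_in_subspace (profinite_topology Grigorchuk)
    (centraliser (profinite_completion Grigorchuk) (profinite_embedding Grigorchuk g))
    (profinite_embedding Grigorchuk ` centraliser Grigorchuk g)"
proof -
  let ?I = "fin_index_normal Grigorchuk"
  let ?X = "\<lambda>N. discrete_topology (carrier (Grigorchuk Mod N))"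
  let ?C = "centraliser (profinite_completion Grigorchuk) (profinite_embedding Grigorchuk g)"
  let ?A = "profinite_embedding Grigorchuk ` centraliser Grigorchuk g"
  interpret G: group Grigorchuk by (rule group_Grigorchuk)
  have AC: "?A \<subseteq> ?C" by (rule G.profinite_embedding_centraliser[OF assms])
  have CP: "?C \<subseteq> carrier (profinite_completion Grigorchuk)" by (auto simp: centraliser_def)
  have top: "topspace (subtopology (profinite_topology Grigorchuk) ?C) = ?C"
    using CP by (auto simp: topspace_profinite_topology)
  have "x \<in> Abstract_Topology.closure_of (subtopology (profinite_topology Grigorchuk) ?C) ?A" if x: "x \<in> ?C" for x
    unfolding in_closure_of
  proof (intro conjI allI impI)
    show "x \<in> topspace (subtopology (profinite_topology Grigorchuk) ?C)" using x top by simp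
  next
    fix T assume T: "x \<in> T \<and> openin (subtopology (profinite_topology Grigorchuk) ?C) T"
    then obtain U where U: "openin (product_topology ?X ?I) U" "T = U \<inter> carrier (profinite_completion Grigorchuk) \<inter> ?C"
      unfolding profinite_topology_def openin_subtopology by blast
    have "x \<in> U" using T U by blast
    from U(1)[unfolded openin_product_topology_alt, rule_format, OF this]
    obtain V where V: "finite {N \<in> ?I. V N \<noteq> topspace (?X N)}" "x \<in> Pi\<^sub>E ?I V" "Pi\<^sub>E ?I V \<subseteq> U"
      by (elim exE conjE) (rule that)
    \<comment> \<open>A basic open set constrains only these finitely many coordinates, where
      \<open>x\<close> can be matched exactly.\<close>
    let ?F = "{N \<in> ?I. V N \<noteq> topspace (?X N)}"
    obtain f where f: "f \<in> centraliser Grigorchuk g" "\<And>N. N \<in> ?F \<Longrightarrow> profinite_embedding Grigorchuk f N = x N"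
      using centraliser_approximation[OF _ x V(1)] assms carrier_Grigorchuk_eq by blast
    let ?y = "profinite_embedding Grigorchuk f"
    have yA: "?y \<in> ?A" using f(1) by blast
    then have yP: "?y \<in> carrier (profinite_completion Grigorchuk)" using AC CP by blast
    have "?y \<in> Pi\<^sub>E ?I V"
    proof (rule PiE_I)
      fix N assume N: "N \<in> ?I"
      show "?y N \<in> V N"
      proof (cases "N \<in> ?F")
        case True
        show ?thesis using PiE_mem[OF V(2) N] f(2)[OF True] by (simp only:)
      next
        case False
        then have "V N = carrier (Grigorchuk Mod N)" using N by simp
        moreover have "?y \<in> (\<Pi>\<^sub>E N\<in>?I. carrier (Grigorchuk Mod N))"
          using yP by (simp add: profinite_completion_def)
        ultimately show ?thesis using PiE_mem[OF _ N] by blast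
      qed
    qed (simp add: profinite_embedding_def)
    then have "?y \<in> T" using V(3) yP yA AC U(2) by blast
    then show "\<exists>y. y \<in> ?A \<and> y \<in> T" using yA by blast
  qed
  moreover have "Abstract_Topology.closure_of (subtopology (profinite_topology Grigorchuk) ?C) ?A \<subseteq> ?C"
    using closure_of_subset_topspace top by metis
  ultimately show ?thesis
    unfolding dense_in_subspace_def using AC by blast
qed

end
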